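(* Let $\mu$ be a symmetric nonnegative Radon measure on $\mathbb{R}\setminus\{0\}$ with $\int (|z|^2\wedge 1)\,\mathrm{d}\mu(z)<+\infty$, and let $\mathcal{L}^\mu$ be the associated nonlocal operator. The following statements are equivalent: (a) If $u\in L^\infty(\mathbb{R})$ satisfies $\mathcal{L}^\mu[u]=0$ in $\mathcal{D}'(\mathbb{R})$, then $u$ is constant (almost everywhere). (b) There exists $a\in\operatorname{supp}(\mu)$ such that $\sup_{b\in\operatorname{supp}(\mu)}\mathcal{Q}(a,b)=+\infty$.
   Context: A nonnegative Radon measure on $\mathbb{R}\setminus\{0\}$ is a nonnegative Borel measure on $\mathbb{R}\setminus\{0\}$ finite on compact subsets of $\mathbb{R}\setminus\{0\}$. It is symmetric if $\mu(B)=\mu(-B)$ for all Borel $B$. Its support is $\operatorname{supp}(\mu)=\{z\in\mathbb{R}\setminus\{0\}:\mu(B_r(z))>0\ \forall r>0\}$, where $B_r(z)$ is the ball of center $z$ and radius $r$ (the support never contains $0$). The symbol $\wedge$ denotes the minimum. The operator $\mathcal{L}^\mu$ is $$\mathcal{L}^\mu[\psi](x)=\mathrm{P.V.}\int_{\mathbb{R}\setminus\{0\}}\big(\psi(x+z)-\psi(x)\big)\,\mathrm{d}\mu(z)=\lim_{r\to0^+}\int_{|z|>r}\big(\psi(x+z)-\psi(x)\big)\,\mathrm{d}\mu(z),$$ well defined for $C^2$ functions $\psi$ bounded together with their derivatives up to order two. For $u\in L^\infty(\mathbb{R})$, "$\mathcal{L}^\mu[u]=0$ in $\mathcal{D}'(\mathbb{R})$"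 means $\int_{\mathbb{R}}u(x)\,\mathcal{L}^\mu[\psi](x)\,\mathrm{d}x=0$ for all $\psi\in C_c^\infty(\mathbb{R})$. For $a,b\in\mathbb{R}\setminus\{0\}$, $\mathcal{Q}(a,b)\in\{1,2,3,\dots\}\cup\{+\infty\}$ is defined by $\mathcal{Q}(a,b)=+\infty$ if $\frac ba\notin\mathbb{Q}$, and $\mathcal{Q}(a,b)=q$ if $\frac ba=\frac pq\in\mathbb{Q}$ with $p\in\mathbb{Z}\setminus\{0\}$, $q\in\{1,2,\dots\}$ and $\gcd(p,q)=1$. *)

theory Defs
  imports "HOL-Analysis.Analysis" "HOL-Library.Extended_Nat"
begin

text \<open>
  Measures on \<open>\<real> \<setminus> {0}\<close> are measures whose \<open>\<sigma>\<close>-algebra is the Borel algebra of the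
  subspace \<open>- {0}\<close>; in particular \<open>space \<mu> = - {0}\<close>, and every set handed to \<open>emeasure \<mu>\<close>
  has to avoid \<open>0\<close>.
\<close>

definition radon_measure_punctured :: "real measure \<Rightarrow> bool" where
  "radon_measure_punctured \<mu> \<longleftrightarrow>
     sets \<mu> = sets (restrict_space borel (- {0})) \<and>
     (\<forall>K. compact K \<and> K \<subseteq> - {0} \<longrightarrow> emeasure \<mu> K < \<infinity>)"

definition symmetric_measure :: "real measure \<Rightarrow> bool" where
  "symmetric_measure \<mu> \<longleftrightarrow> (\<forall>B\<in>sets \<mu>. emeasure \<mu> B = emeasure \<mu> (uminus ` B))"

definition measure_support :: "real measure \<Rightarrow> real set" where
  "measure_support \<mu> = {z. z \<noteq> 0 \<and> (\<forall>r>0. emeasure \<mu> (ball z r - {0}) > 0)}"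

definition levy_operator :: "real measure \<Rightarrow> (real \<Rightarrow> real) \<Rightarrow> real \<Rightarrow> real" where
  "levy_operator \<mu> \<psi> x =
     Lim (at_right 0) (\<lambda>r. LINT z:{z. \<bar>z\<bar> > r}|\<mu>. (\<psi> (x + z) - \<psi> x))"

definition test_functions :: "(real \<Rightarrow> real) set" where
  "test_functions =
     {\<psi>. (\<forall>k. (deriv ^^ k) \<psi> differentiable_on UNIV) \<and> compact (closure {x. \<psi> x \<noteq> 0})}"

text \<open>Functions are not identified when they agree almost everywhere.\<close>

definition L_infinity :: "(real \<Rightarrow> real) set" where
  "L_infinity = {u \<in> borel_measurable lebesgue. \<exists>C. AE x in lebesgue. \<bar>u x\<bar> \<le> C}"

definition levy_harmonic :: "real measure \<Rightarrow> (real \<Rightarrow> real) \<Rightarrow> bool" where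
  "levy_harmonic \<mu> u \<longleftrightarrow>
     (\<forall>\<psi>\<in>test_functions. (LINT x|lebesgue. u x * levy_operator \<mu> \<psi> x) = 0)"

definition reduced_denominator :: "real \<Rightarrow> real \<Rightarrow> enat" where
  "reduced_denominator a b =
     (if b / a \<in> \<rat>
      then enat (THE q. q \<ge> 1 \<and> (\<exists>p::int. p \<noteq> 0 \<and> coprime p (int q) \<and> b / a = of_int p / of_nat q))
      else \<infinity>)"

lemma reduced_denominator_eq:
  assumes "a \<noteq> 0" "b \<noteq> 0" "q \<ge> 1" "coprime p (int q)" "b / a = of_int p / of_nat q"
  shows "reduced_denominator a b = enat q"
proof -
  have p: "p \<noteq> 0" using assms by auto
  have rat: "b / a \<in> \<rat>" unfolding assms(5) by simp
  have uniq: "q' = q"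
    if h: "q' \<ge> 1 \<and> (\<exists>p'::int. p' \<noteq> 0 \<and> coprime p' (int q') \<and> b / a = of_int p' / of_nat q')"
    for q' :: nat
  proof -
    obtain p' where c: "coprime p' (int q')" and e: "b / a = of_int p' / of_nat q'"
      using h by blast
    have "real_of_int (p * int q') = real_of_int (p' * int q)"
      using e assms(3,5) h by (simp add: field_simps)
    hence e': "p * int q' = p' * int q" using of_int_eq_iff by blast
    have "int q dvd p * int q'" "int q' dvd p' * int q"
      using e' by (metis dvd_triv_right)+
    hence "int q dvd int q'" "int q' dvd int q"
      using assms(4) c by (simp_all add: coprime_dvd_mult_right_iff coprime_commute)
    thus ?thesis by (simp add: dvd_antisym)
  qed
  have "(THE q. q \<ge> 1 \<and> (\<exists>p::int. p \<noteq> 0 \<and> coprime p (int q) \<and> b / a = of_int p / of_nat q)) = q"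
    by (rule the_equality) (use assms p uniq in blast)+
  thus ?thesis unfolding reduced_denominator_def using rat by simp
qed

end

theory Submission
  imports Defs
begin

text \<open>
  By symmetry, \<open>\<L>\<^sup>\<mu>[\<psi>](x) = 1/2 \<integral> (\<psi>(x + z) + \<psi>(x - z) - 2 \<psi>(x)) d\<mu>(z)\<close> without principal value, so by
  Fubini every correlation \<open>v\<close> of a bounded harmonic \<open>u\<close> with a test function satisfies
  \<open>\<integral> (v(x + z) + v(x - z) - 2 v(x)) d\<mu>(z) = 0\<close> pointwise. If \<open>h\<close> is in the support and
  \<open>w(x) = v(x + h) - v(x)\<close> has supremum \<open>M > 0\<close>, then the equation at a point where \<open>w\<close> is almost
  maximal forces \<open>w\<close> to be almost maximal at \<open>x + h\<close>, \<open>x + 2h\<close>, ..., and summing these increments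
  makes \<open>v\<close> unbounded (the Choquet-Deny argument). Hence every \<open>h\<close> in the support is a period of the
  Lipschitz function \<open>v\<close>. Under (b) there are arbitrarily small periods (by Bezout or by Dirichlet
  approximation), so all correlations are constant, and so is \<open>u\<close>. If (b) fails, then the support lies in
  some \<open>g\<int>\<close>, and \<open>cos (2 \<pi> x / g)\<close> is a nonconstant harmonic function.
\<close>

section \<open>Second differences of test functions\<close>

definition second_diff :: "(real \<Rightarrow> real) \<Rightarrow> real \<Rightarrow> real \<Rightarrow> real" where
  "second_diff f z x = f (x + z) + f (x - z) - 2 * f x"

text \<open>The mean value theorem on either side of x gives z * (f' s - f' t) with s and t within
  |z| of x; the Lipschitz bound on f' then supplies the second factor |z|.\<close>

lemma second_diff_bound:
  fixes f f' :: "real \<Rightarrow> real"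
  assumes f: "\<And>x. (f has_real_derivative f' x) (at x)"
    and f': "\<And>x y. \<bar>f' x - f' y\<bar> \<le> K * \<bar>x - y\<bar>"
  shows "\<bar>second_diff f z x\<bar> \<le> 2 * K * z\<^sup>2"
proof -
  \<comment> \<open>Mean value theorem for increments of either sign, since z may be negative or
    zero.\<close>
  have mvt: "\<exists>\<xi>. \<bar>\<xi> - a\<bar> \<le> \<bar>t\<bar> \<and> f (a + t) - f a = t * f' \<xi>" for a t
  proof (cases t "0 :: real" rule: linorder_cases)
    case less
    then obtain \<xi> where "a + t < \<xi>" "\<xi> < a" "f a - f (a + t) = (a - (a + t)) * f' \<xi>"
      using MVT2[of "a + t" a f f'] f by auto
    then show ?thesis by (intro exI[of _ \<xi>]) (auto simp: algebra_simps)
  next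
    case equal
    then show ?thesis by auto
  next
    case greater
    then obtain \<xi> where "a < \<xi>" "\<xi> < a + t" "f (a + t) - f a = (a + t - a) * f' \<xi>"
      using MVT2[of a "a + t" f f'] f by auto
    then show ?thesis by (intro exI[of _ \<xi>]) auto
  qed
  have K: "0 \<le> K" using f'[of 1 0] by simp
  obtain s where s: "\<bar>s - x\<bar> \<le> \<bar>z\<bar>" "f (x + z) - f x = z * f' s" using mvt by blast
  obtain t where t: "\<bar>t - x\<bar> \<le> \<bar>z\<bar>" "f (x - z) - f x = - z * f' t"
    using mvt[of x "- z"] by auto
  have "second_diff f z x = z * (f' s - f' t)"
    using s(2) t(2) by (simp add: second_diff_def algebra_simps)
  then have "\<bar>second_diff f z x\<bar> \<le> \<bar>z\<bar> * (K * \<bar>s - t\<bar>)"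
    using f' by (simp add: abs_mult mult_left_mono)
  also have "\<dots> \<le> \<bar>z\<bar> * (K * (2 * \<bar>z\<bar>))"
    using s(1) t(1) K by (intro mult_left_mono) auto
  finally show ?thesis by (simp add: power2_eq_square algebra_simps)
qed

text \<open>Collects, free of derivatives, what the integral estimates use of a test function; one
  constant K serves all the bounds.\<close>

definition tame :: "real \<Rightarrow> real \<Rightarrow> (real \<Rightarrow> real) \<Rightarrow> bool" where
  "tame R K f \<longleftrightarrow> 0 < R \<and> 0 \<le> K \<and> continuous_on UNIV f \<and> (\<forall>x. \<bar>x\<bar> > R \<longrightarrow> f x = 0) \<and>
     (\<forall>x. \<bar>f x\<bar> \<le> K) \<and> (\<forall>x y. \<bar>f x - f y\<bar> \<le> K * \<bar>x - y\<bar>) \<and>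
     (\<forall>z x. \<bar>second_diff f z x\<bar> \<le> K * z\<^sup>2)"

lemma bounded_of_compact_support:
  fixes f :: "real \<Rightarrow> real"
  assumes "continuous_on UNIV f" "\<And>x. \<bar>x\<bar> > R \<Longrightarrow> f x = 0"
  obtains B where "0 \<le> B" "\<And>x. \<bar>f x\<bar> \<le> B"
proof -
  have "compact (f ` {-R..R})"
    by (intro compact_continuous_image continuous_on_subset[OF assms(1)]) auto
  then obtain B where B: "\<And>x. x \<in> {-R..R} \<Longrightarrow> \<bar>f x\<bar> \<le> B"
    using compact_imp_bounded bounded_iff by (metis imageI real_norm_def)
  show thesis
  proof (rule that[of "\<bar>B\<bar>"])
    fix x show "\<bar>f x\<bar> \<le> \<bar>B\<bar>"
    proof (cases "\<bar>x\<bar> > R")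
      case False
      then have "x \<in> {-R..R}" by auto
      from B[OF this] show ?thesis by linarith
    qed (simp add: assms(2))
  qed simp
qed

lemma deriv_zero_outside:
  fixes f :: "real \<Rightarrow> real"
  assumes "\<And>x. \<bar>x\<bar> > R \<Longrightarrow> f x = 0" "\<bar>x\<bar> > R"
  shows "deriv f x = 0"
proof -
  have "open {x :: real. \<bar>x\<bar> > R}"
    by (intro open_Collect_less continuous_intros)
  then have "(f has_real_derivative 0) (at x)"
    using assms
    by (intro has_field_derivative_transform_within_open[where f = "\<lambda>_. 0" and g = f]) auto
  then show ?thesis by (rule DERIV_imp_deriv)
qed

lemma lipschitz_of_bounded_deriv:
  fixes f f' :: "real \<Rightarrow> real"
  assumes "\<And>x. (f has_real_derivative f' x) (at x)" "\<And>x. \<bar>f' x\<bar> \<le> B"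
  shows "\<bar>f x - f y\<bar> \<le> B * \<bar>x - y\<bar>"
  using field_differentiable_bound[of UNIV f f' B x y] assms by auto

text \<open>Every derivative is continuous and vanishes outside the same interval, hence is bounded.
  The bounds on f, f' and f'' yield the three estimates in \<open>tame\<close>.\<close>

lemma test_function_tame:
  assumes "f \<in> test_functions"
  obtains R K where "tame R K f"
proof -
  have diff: "(deriv ^^ k) f differentiable_on UNIV" for k
    using assms by (simp add: test_functions_def)
  have der: "((deriv ^^ k) f has_real_derivative (deriv ^^ Suc k) f x) (at x)" for k x
  proof -
    have "(deriv ^^ k) f differentiable at x"
      using diff[of k] by (simp add: differentiable_on_def)
    then show ?thesis
      by (simp add: DERIV_deriv_iff_real_differentiable)
  qed
  have cont: "continuous_on UNIV ((deriv ^^ k) f)" for k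
    using diff by (rule differentiable_imp_continuous_on)
  have "bounded {x. f x \<noteq> 0}"
    using assms compact_imp_bounded bounded_closure_image
    unfolding test_functions_def by (auto intro: bounded_subset closure_subset)
  then obtain R where R: "0 < R" "\<And>x. f x \<noteq> 0 \<Longrightarrow> \<bar>x\<bar> \<le> R"
    unfolding bounded_pos by auto
  have zero: "\<bar>x\<bar> > R \<Longrightarrow> (deriv ^^ k) f x = 0" for k x
  proof (induction k arbitrary: x)
    case 0 then show ?case using R(2)[of x] by auto
  next
    case (Suc k) then show ?case using deriv_zero_outside[of R "(deriv ^^ k) f"] by simp
  qed
  have "\<exists>B. 0 \<le> B \<and> (\<forall>x. \<bar>(deriv ^^ k) f x\<bar> \<le> B)" for k
    using bounded_of_compact_support[OF cont zero] by metis
  then obtain B where B: "\<And>k. 0 \<le> B k" "\<And>k x. \<bar>(deriv ^^ k) f x\<bar> \<le> B k"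
    by metis
  \<comment> \<open>K dominates the sup bound \<open>B 0\<close>, the Lipschitz constant
    \<open>B 1\<close> and the factor \<open>2 * B 2\<close> coming from
    \<open>second_diff_bound\<close>.\<close>
  define K where "K = B 0 + B 1 + 2 * B 2"
  have le: "B 0 \<le> K" "B 1 \<le> K" "2 * B 2 \<le> K" "0 \<le> K"
    using B(1)[of 0] B(1)[of 1] B(1)[of 2] by (auto simp: K_def)
  have lip: "\<bar>(deriv ^^ k) f x - (deriv ^^ k) f y\<bar> \<le> B (Suc k) * \<bar>x - y\<bar>" for k x y
    by (rule lipschitz_of_bounded_deriv[OF der B(2)])
  have "\<bar>second_diff f z x\<bar> \<le> 2 * B 2 * z\<^sup>2" for z x
    using second_diff_bound[of f "deriv f" "B 2"] der[of 0] lip[of 1] by (simp add: numeral_2_eq_2)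
  then have "\<bar>second_diff f z x\<bar> \<le> K * z\<^sup>2" for z x
    using le(3) by (meson mult_right_mono order_trans zero_le_power2)
  moreover have "\<bar>f x - f y\<bar> \<le> K * \<bar>x - y\<bar>" for x y
    using lip[of 0 x y] le(2) by simp (meson abs_ge_zero mult_right_mono order_trans)
  moreover have "\<bar>f x\<bar> \<le> K" for x using B(2)[of 0 x] le(1) by simp
  ultimately have "tame R K f"
    using R le(4) zero[of _ 0] cont[of 0] by (auto simp: tame_def)
  then show thesis by (rule that)
qed

lemma tame_borel [measurable_dest]: "tame R K f \<Longrightarrow> f \<in> borel_measurable borel"
  unfolding tame_def by (intro borel_measurable_continuous_onI) auto

lemma tame_indicator_bound: "tame R K f \<Longrightarrow> \<bar>f x\<bar> \<le> K * indicator {-R..R} x"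
  unfolding tame_def by (cases "\<bar>x\<bar> > R") (auto simp: indicator_def abs_le_iff)

lemma tame_integral:
  assumes "tame R K f"
  shows "(\<integral>\<^sup>+ x. ennreal \<bar>f (x + t)\<bar> \<partial>lborel) \<le> ennreal (K * (2 * R))"
proof -
  have R: "0 < R" "0 \<le> K" using assms by (auto simp: tame_def)
  have [measurable]: "f \<in> borel_measurable borel" using assms by (rule tame_borel)
  have "(\<integral>\<^sup>+ x. ennreal \<bar>f (x + t)\<bar> \<partial>lborel) = (\<integral>\<^sup>+ x. ennreal \<bar>f x\<bar> \<partial>lborel)"
    using nn_integral_real_affine[of "\<lambda>x. ennreal \<bar>f x\<bar>" 1 t] by (simp add: add.commute)
  also have "\<dots> \<le> (\<integral>\<^sup>+ x. ennreal K * indicator {-R..R} x \<partial>lborel)"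
    using tame_indicator_bound[OF assms]
    by (intro nn_integral_mono) (auto simp flip: ennreal_indicator ennreal_mult'' intro!: ennreal_leI)
  also have "\<dots> = ennreal K * ennreal (2 * R)"
    using R by (subst nn_integral_cmult_indicator) simp_all
  also have "\<dots> = ennreal (K * (2 * R))"
    using R by (subst ennreal_mult''[symmetric]) simp_all
  finally show ?thesis .
qed

text \<open>For |z| \<le> 1 the second difference lives on [-(R + 1), R + 1] and is at most K z^2
  there; for |z| > 1 each of the four copies of f contributes at most 2 R K. The constant 8 covers
  both cases, and the weight min (z^2) 1 is the one integrable under the moment condition.\<close>

lemma tame_second_diff_integral:
  assumes "tame R K f"
  shows "(\<integral>\<^sup>+ x. ennreal \<bar>second_diff f z x\<bar> \<partial>lborel) \<le> ennreal (8 * (R + 1) * K * min (z\<^sup>2) 1)"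
proof -
  have R: "0 < R" "0 \<le> K" using assms by (auto simp: tame_def)
  have [measurable]: "f \<in> borel_measurable borel" using assms by (rule tame_borel)
  show ?thesis
  proof (cases "\<bar>z\<bar> \<le> 1")
    case True
    then have z: "z\<^sup>2 \<le> 1" by (simp add: abs_square_le_1)
    have "\<bar>second_diff f z x\<bar> \<le> (K * z\<^sup>2) * indicator {-(R + 1)..R + 1} x" for x
    proof (cases "x \<in> {-(R + 1)..R + 1}")
      case False
      then have "f (x + z) = 0" "f (x - z) = 0" "f x = 0"
        using assms True unfolding tame_def by (auto simp: abs_if split: if_splits)
      then show ?thesis using False by (simp add: second_diff_def)
    qed (use assms in \<open>auto simp: tame_def\<close>)
    then have "(\<integral>\<^sup>+ x. ennreal \<bar>second_diff f z x\<bar> \<partial>lborel)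
        \<le> (\<integral>\<^sup>+ x. ennreal (K * z\<^sup>2) * indicator {-(R + 1)..R + 1} x \<partial>lborel)"
      by (intro nn_integral_mono) (auto simp flip: ennreal_indicator ennreal_mult'' intro!: ennreal_leI)
    also have "\<dots> = ennreal (K * z\<^sup>2) * ennreal (R + 1 - (-(R + 1)))"
      using R by (subst nn_integral_cmult_indicator) simp_all
    also have "\<dots> = ennreal (2 * (R + 1) * K * z\<^sup>2)"
      using R by (subst ennreal_mult''[symmetric]) (simp_all add: algebra_simps)
    also have "\<dots> \<le> ennreal (8 * (R + 1) * K * min (z\<^sup>2) 1)"
      using z R by (intro ennreal_leI) (simp add: mult_right_mono min_def)
    finally show ?thesis .
  next
    case False
    then have z: "min (z\<^sup>2) 1 = 1" by (simp add: abs_square_le_1 min_def) 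
    let ?a = "K * (2 * R)"
    have "(\<integral>\<^sup>+ x. ennreal \<bar>second_diff f z x\<bar> \<partial>lborel)
        \<le> (\<integral>\<^sup>+ x. (ennreal \<bar>f (x + z)\<bar> + ennreal \<bar>f (x + - z)\<bar>) +
             (ennreal \<bar>f (x + 0)\<bar> + ennreal \<bar>f (x + 0)\<bar>) \<partial>lborel)"
      by (intro nn_integral_mono) (auto simp: second_diff_def simp flip: ennreal_plus intro!: ennreal_leI)
    also have "\<dots> = ((\<integral>\<^sup>+ x. ennreal \<bar>f (x + z)\<bar> \<partial>lborel) + (\<integral>\<^sup>+ x. ennreal \<bar>f (x + - z)\<bar> \<partial>lborel)) +
        ((\<integral>\<^sup>+ x. ennreal \<bar>f (x + 0)\<bar> \<partial>lborel) + (\<integral>\<^sup>+ x. ennreal \<bar>f (x + 0)\<bar> \<partial>lborel))"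
      by (simp add: nn_integral_add)
    also have "\<dots> \<le> (ennreal ?a + ennreal ?a) + (ennreal ?a + ennreal ?a)"
      by (intro add_mono tame_integral[OF assms])
    also have "\<dots> = ennreal (8 * R * K)"
      using R by (simp flip: ennreal_plus)
    also have "\<dots> \<le> ennreal (8 * (R + 1) * K * min (z\<^sup>2) 1)"
      using z R by (intro ennreal_leI) (simp add: algebra_simps)
    finally show ?thesis .
  qed
qed

section \<open>Bump functions approximating indicators\<close>

text \<open>
  For fixed \<open>W\<close>, \<open>a\<close>, \<open>b\<close> as in \<open>bump_weight\<close>, this family is closed under differentiation.
\<close>
definition flat :: "real poly \<Rightarrow> real \<Rightarrow> real \<Rightarrow> real poly \<Rightarrow> nat \<Rightarrow> real \<Rightarrow> real" where
  "flat W a b p n x = (if a < x \<and> x < b then poly p x * inverse (poly W x) ^ n * exp (- inverse (poly W x)) else 0)"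

definition bump_weight :: "real \<Rightarrow> real \<Rightarrow> real \<Rightarrow> real poly" where
  "bump_weight a b c = smult c ([:- a, 1:] * [:b, - 1:])"

text \<open>A standard smooth cutoff with a steepness parameter: as the positive c grows, it
  increases to the indicator of the open interval.\<close>

definition bump :: "real \<Rightarrow> real \<Rightarrow> real \<Rightarrow> real \<Rightarrow> real" where
  "bump a b c x = (if a < x \<and> x < b then exp (- 1 / (c * ((x - a) * (b - x)))) else 0)"

lemma poly_bump_weight: "poly (bump_weight a b c) x = c * ((x - a) * (b - x))"
  by (simp add: bump_weight_def algebra_simps)

text \<open>With r = 1 / w, the single term r^(n + 2) / (n + 2)! of the exponential series is at
  most exp r. The two extra powers of w give the quadratic decay at the endpoints of a bump.\<close>

lemma power_exp_inverse_bound: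
  fixes w :: real
  assumes "0 < w"
  shows "inverse w ^ n * exp (- inverse w) \<le> fact (n + 2) * w\<^sup>2"
proof -
  let ?r = "inverse w" and ?F = "fact (n + 2) :: real"
  have r: "0 < ?r" "?r * w = 1" using assms by auto
  have "(\<Sum>k\<in>{n + 2}. ?r ^ k /\<^sub>R fact k) \<le> (\<Sum>k. ?r ^ k /\<^sub>R fact k)"
    using r by (intro sum_le_suminf summable_exp_generic) auto
  then have "?r ^ (n + 2) / ?F \<le> exp ?r"
    by (simp add: exp_def divide_inverse mult.commute del: fact_Suc)
  then have 1: "?r ^ (n + 2) \<le> exp ?r * ?F"
    by (subst (asm) pos_divide_le_eq) (simp_all del: fact_Suc)
  have "?r ^ n * exp (- ?r) = ?r ^ (n + 2) * exp (- ?r) * w\<^sup>2"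
  proof -
    have "?r ^ (n + 2) * w\<^sup>2 = ?r ^ n * (?r * w)\<^sup>2"
      by (simp only: power_add power_mult_distrib mult.assoc)
    then show ?thesis using r(2) by (simp add: mult.commute mult.left_commute)
  qed
  also have "\<dots> \<le> (exp ?r * ?F) * exp (- ?r) * w\<^sup>2"
    using 1 by (intro mult_right_mono) auto
  also have "\<dots> = (exp ?r * exp (- ?r)) * ?F * w\<^sup>2" by (simp only: mult_ac)
  also have "exp ?r * exp (- ?r) = 1" by (simp only: exp_add[symmetric]) simp
  finally show ?thesis by simp
qed

text \<open>The weight vanishes linearly at both endpoints and
  \<open>power_exp_inverse_bound\<close> makes \<open>flat\<close> quadratically small in the
  weight. The bound is uniform over all x outside the open interval and so gives derivative 0 at
  each of them, endpoints included.\<close>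

lemma flat_quadratic_bound:
  assumes "a < b" "0 < c"
  obtains B where "\<And>x y. \<not> (a < x \<and> x < b) \<Longrightarrow> \<bar>flat (bump_weight a b c) a b p n y\<bar> \<le> B * (y - x)\<^sup>2"
proof -
  have "compact (poly p ` {a..b})"
    by (intro compact_continuous_image continuous_intros) auto
  then obtain P where P: "\<And>x. x \<in> {a..b} \<Longrightarrow> \<bar>poly p x\<bar> \<le> P"
    using compact_imp_bounded bounded_iff by (metis imageI real_norm_def)
  have P0: "0 \<le> P" using P[of a] assms by auto
  show thesis
  proof (rule that)
    fix x y assume x: "\<not> (a < x \<and> x < b)"
    define w where "w = c * ((y - a) * (b - y))"
    have W: "poly (bump_weight a b c) y = w" by (simp only: poly_bump_weight w_def)
    show "\<bar>flat (bump_weight a b c) a b p n y\<bar> \<le> (P * (fact (n + 2) * (c * (b - a))\<^sup>2)) * (y - x)\<^sup>2"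
    proof (cases "a < y \<and> y < b")
      case True
      have w: "0 < w" using True assms by (simp add: w_def)
      \<comment> \<open>An endpoint lies between x and y: the factor belonging to it is at most |y -
        x|, the other one at most b - a.\<close>
      have "(y - a) * (b - y) \<le> (b - a) * \<bar>y - x\<bar>"
      proof (cases "x \<le> a")
        case True
        then have "(b - y) * (y - a) \<le> (b - a) * (y - x)"
          using \<open>a < y \<and> y < b\<close> by (intro mult_mono) auto
        then show ?thesis using True \<open>a < y \<and> y < b\<close> by (simp add: mult.commute)
      next
        case False
        then have "(y - a) * (b - y) \<le> (b - a) * (x - y)"
          using \<open>a < y \<and> y < b\<close> x by (intro mult_mono) auto
        then show ?thesis using False x \<open>a < y \<and> y < b\<close> by simp
      qed
      then have "w \<le> c * (b - a) * \<bar>y - x\<bar>" using assms by (simp add: w_def mult.assoc)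
      then have w2: "w\<^sup>2 \<le> (c * (b - a))\<^sup>2 * (y - x)\<^sup>2"
        using w power_mono[of w "c * (b - a) * \<bar>y - x\<bar>" 2] by (simp add: power_mult_distrib)
      have "\<bar>flat (bump_weight a b c) a b p n y\<bar> = \<bar>poly p y\<bar> * (inverse w ^ n * exp (- inverse w))"
        using True w by (simp add: flat_def W abs_mult power_abs)
      also have "\<dots> \<le> P * (fact (n + 2) * w\<^sup>2)"
        using True P P0 w by (intro mult_mono power_exp_inverse_bound) auto
      also have "\<dots> \<le> P * (fact (n + 2) * ((c * (b - a))\<^sup>2 * (y - x)\<^sup>2))"
        using w2 P0 by (intro mult_left_mono) auto
      finally show ?thesis by (simp add: mult.assoc)
    qed (use P0 in \<open>auto simp: flat_def\<close>)
  qed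
qed

lemma has_derivative_zero_of_quadratic_bound:
  fixes f :: "real \<Rightarrow> real"
  assumes "\<And>y. \<bar>f y\<bar> \<le> B * (y - x)\<^sup>2"
  shows "(f has_real_derivative 0) (at x)"
proof -
  have fx: "f x = 0" using assms[of x] by simp
  have "((\<lambda>h. B * \<bar>h\<bar>) \<longlongrightarrow> 0) (at 0)" by (auto intro!: tendsto_eq_intros)
  moreover have "eventually (\<lambda>h. norm ((f (x + h) - f x) / h) \<le> B * \<bar>h\<bar>) (at 0)"
  proof -
    have "norm ((f (x + h) - f x) / h) \<le> B * \<bar>h\<bar>" if "h \<noteq> 0" for h
    proof -
      have "\<bar>f (x + h)\<bar> \<le> B * \<bar>h\<bar> * \<bar>h\<bar>"
        using assms[of "x + h"] by (simp add: power2_eq_square mult.assoc)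
      then show ?thesis using that by (simp add: fx pos_divide_le_eq)
    qed
    then show ?thesis by (auto simp: eventually_at_filter)
  qed
  ultimately have "((\<lambda>h. (f (x + h) - f x) / h) \<longlongrightarrow> 0) (at 0)"
    by (rule Lim_null_comparison[rotated])
  then show ?thesis by (simp add: DERIV_def)
qed

text \<open>Inside the interval this is the product rule, with all terms brought to the common power
  n + 2 of 1 / W; elsewhere both sides are 0 by the quadratic bound.\<close>

lemma flat_has_derivative:
  assumes "a < b" "0 < c"
  defines "W \<equiv> bump_weight a b c"
  shows "(flat W a b p n has_real_derivative
    flat W a b (pderiv p * W * W - smult (of_nat n) (p * pderiv W * W) + p * pderiv W) (n + 2) x) (at x)"
proof (cases "a < x \<and> x < b")
  case False
  then show ?thesis
    using flat_quadratic_bound[OF assms(1,2), of p n]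
    by (metis W_def flat_def has_derivative_zero_of_quadratic_bound)
next
  case True
  define w where "w = poly W x"
  have w: "0 < w" using True assms(2) by (simp add: w_def W_def poly_bump_weight)
  define r where "r x = inverse (poly W x)" for x
  have rw: "r x * w = 1" using w by (simp add: r_def w_def)
  have r': "(r has_real_derivative - (poly (pderiv W) x * (r x)\<^sup>2)) (at x)"
    unfolding r_def using w
    by (auto intro!: derivative_eq_intros poly_DERIV simp: w_def power2_eq_square)
  have D: "((\<lambda>x. poly p x * r x ^ n * exp (- r x)) has_real_derivative
      (poly (pderiv p) x * r x ^ n
        + (of_nat n * (- (poly (pderiv W) x * (r x)\<^sup>2) * r x ^ (n - 1))) * poly p x) * exp (- r x)
      + exp (- r x) * (poly (pderiv W) x * (r x)\<^sup>2) * (poly p x * r x ^ n)) (at x)"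
    by (rule derivative_eq_intros poly_DERIV r' refl | simp)+
  have E: "poly (pderiv p) x * r x ^ n
        + (of_nat n * (- (poly (pderiv W) x * (r x)\<^sup>2) * r x ^ (n - 1))) * poly p x
        + (poly (pderiv W) x * (r x)\<^sup>2) * (poly p x * r x ^ n)
      = poly (pderiv p * W * W - smult (of_nat n) (p * pderiv W * W) + p * pderiv W) x * r x ^ (n + 2)"
  proof -
    \<comment> \<open>Missing powers of r are created by inserting the factor r * w = 1.\<close>
    have "r x ^ n = (r x * w) * (r x * w) * r x ^ n" using rw by simp
    then have 1: "r x ^ n = w * w * r x ^ (n + 2)" by (simp add: mult_ac)
    \<comment> \<open>For n = 0 the truncated exponent n - 1 is harmless, because the factor
      \<open>of_nat n\<close> vanishes.\<close>
    have "of_nat n * ((r x)\<^sup>2 * r x ^ (n - 1)) = of_nat n * r x ^ (n + 1)"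
      by (cases n) (simp_all add: power2_eq_square)
    also have "r x ^ (n + 1) = (r x * w) * r x ^ (n + 1)" using rw by simp
    also have "\<dots> = w * r x ^ (n + 2)" by (simp add: mult_ac)
    finally have 2: "of_nat n * ((r x)\<^sup>2 * r x ^ (n - 1)) = of_nat n * (w * r x ^ (n + 2))" .
    have 3: "(r x)\<^sup>2 * r x ^ n = r x ^ (n + 2)" by (simp add: power2_eq_square)
    have "poly (pderiv p) x * r x ^ n
        + (of_nat n * (- (poly (pderiv W) x * (r x)\<^sup>2) * r x ^ (n - 1))) * poly p x
        + (poly (pderiv W) x * (r x)\<^sup>2) * (poly p x * r x ^ n)
      = poly (pderiv p) x * r x ^ n
        - poly (pderiv W) x * poly p x * (of_nat n * ((r x)\<^sup>2 * r x ^ (n - 1)))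
        + poly (pderiv W) x * poly p x * ((r x)\<^sup>2 * r x ^ n)"
      by algebra
    also have "\<dots> = poly (pderiv p) x * (w * w * r x ^ (n + 2))
        - poly (pderiv W) x * poly p x * (of_nat n * (w * r x ^ (n + 2)))
        + poly (pderiv W) x * poly p x * r x ^ (n + 2)"
      by (simp only: 1[symmetric] 2 3)
    also have "\<dots> = (poly (pderiv p) x * w * w - of_nat n * (poly p x * poly (pderiv W) x * w)
        + poly p x * poly (pderiv W) x) * r x ^ (n + 2)"
      by algebra
    finally show ?thesis by (simp only: poly_add poly_diff poly_mult poly_smult w_def)
  qed
  have "(poly (pderiv p) x * r x ^ n
        + (of_nat n * (- (poly (pderiv W) x * (r x)\<^sup>2) * r x ^ (n - 1))) * poly p x) * exp (- r x)
      + exp (- r x) * (poly (pderiv W) x * (r x)\<^sup>2) * (poly p x * r x ^ n)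
    = (poly (pderiv p) x * r x ^ n
        + (of_nat n * (- (poly (pderiv W) x * (r x)\<^sup>2) * r x ^ (n - 1))) * poly p x
        + (poly (pderiv W) x * (r x)\<^sup>2) * (poly p x * r x ^ n)) * exp (- r x)"
    by algebra
  with D have "((\<lambda>x. poly p x * r x ^ n * exp (- r x)) has_real_derivative
      poly (pderiv p * W * W - smult (of_nat n) (p * pderiv W * W) + p * pderiv W) x * r x ^ (n + 2) * exp (- r x)) (at x)"
    unfolding E by (simp only:)
  then have "((\<lambda>x. poly p x * r x ^ n * exp (- r x)) has_real_derivative
      flat W a b (pderiv p * W * W - smult (of_nat n) (p * pderiv W * W) + p * pderiv W) (n + 2) x) (at x)"
    using True by (simp only: flat_def r_def simp_thms if_True)
  then show ?thesis
    by (rule has_field_derivative_transform_within_open[where S = "{a<..<b}"])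
      (use True in \<open>auto simp: flat_def r_def\<close>)
qed

lemma flat_deriv_iterate:
  assumes "a < b" "0 < c"
  shows "\<exists>q m. (deriv ^^ k) (flat (bump_weight a b c) a b p n) = flat (bump_weight a b c) a b q m"
proof (induction k)
  case (Suc k)
  then obtain q m where "(deriv ^^ k) (flat (bump_weight a b c) a b p n) = flat (bump_weight a b c) a b q m"
    by blast
  moreover have "deriv (flat (bump_weight a b c) a b q m) = flat (bump_weight a b c) a b
      (pderiv q * bump_weight a b c * bump_weight a b c
        - smult (of_nat m) (q * pderiv (bump_weight a b c) * bump_weight a b c)
        + q * pderiv (bump_weight a b c)) (m + 2)"
    using DERIV_imp_deriv[OF flat_has_derivative[OF assms]] by blast
  ultimately show ?case by auto
qed auto

lemma bump_test_function:
  assumes "a < b" "0 < c"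
  shows "bump a b c \<in> test_functions"
proof -
  have "bump a b c = flat (bump_weight a b c) a b 1 0"
    by (intro ext) (simp add: bump_def flat_def poly_bump_weight divide_inverse del: inverse_mult_distrib)
  moreover have "flat (bump_weight a b c) a b p n differentiable_on UNIV" for p n
    using flat_has_derivative[OF assms]
    by (meson differentiable_at_imp_differentiable_on real_differentiable_def)
  ultimately have "(deriv ^^ k) (bump a b c) differentiable_on UNIV" for k
    using flat_deriv_iterate[OF assms, of k 1 0] by auto
  moreover have "bounded {x. bump a b c x \<noteq> 0}"
    by (rule bounded_subset[of "{a..b}"]) (auto simp: bump_def)
  ultimately show ?thesis by (simp add: test_functions_def compact_closure)
qed

text \<open>Keeps translates within the family, so that \<open>bump_test_function\<close> also
  supplies the translated test functions used for correlations.\<close>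

lemma bump_shift: "bump a b c (y - x) = bump (a + x) (b + x) c y"
proof -
  have "(y - x - a) * (b - (y - x)) = (y - (a + x)) * (b + x - y)" by (simp add: algebra_simps)
  moreover have "a < y - x \<and> y - x < b \<longleftrightarrow> a + x < y \<and> y < b + x" by auto
  ultimately show ?thesis by (simp only: bump_def)
qed

lemma bump_bounds: "0 < c \<Longrightarrow> 0 \<le> bump a b c x" "0 < c \<Longrightarrow> bump a b c x \<le> indicator {a<..b} x"
  by (auto simp: bump_def indicator_def)

text \<open>Half-open cells are used because adjacent ones fit together without overlap. The price
  is the point b, where every bump is 0 and the indicator is 1.\<close>

lemma bump_tendsto:
  assumes "x \<noteq> b"
  shows "(\<lambda>n. bump a b (Suc n) x) \<longlonglongrightarrow> indicator {a<..b} x"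
proof (cases "a < x \<and> x < b")
  case True
  define t where "t = (x - a) * (b - x)"
  have "0 < t" using True by (simp add: t_def)
  then have "(\<lambda>n. exp (- 1 / (real (Suc n) * t))) \<longlonglongrightarrow> 1" by real_asymp
  then show ?thesis using True by (simp add: bump_def t_def)
qed (use assms in \<open>auto simp: bump_def indicator_def\<close>)

lemma bump_measurable [measurable]: "bump a b c \<in> borel_measurable borel"
  unfolding bump_def by measurable

section \<open>Almost everywhere constancy from translation invariant integrals\<close>

definition cell_integral :: "(real \<Rightarrow> real) \<Rightarrow> real \<Rightarrow> real \<Rightarrow> real" where
  "cell_integral u a b = (\<integral>y. u y * indicator {a<..b} y \<partial>lborel)"

lemma cell_indicator_integrable: "integrable lborel (\<lambda>y. c * indicator {a<..b} y :: real)" for a b c :: real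
  by (cases "a \<le> b") (auto intro!: integrable_mult_right integrable_real_indicator)

lemma cell_integrable:
  fixes u :: "real \<Rightarrow> real"
  assumes [measurable]: "u \<in> borel_measurable borel" and C: "\<And>x. \<bar>u x\<bar> \<le> C"
  shows "integrable lborel (\<lambda>y. u y * indicator {a<..b} y)"
proof (rule Bochner_Integration.integrable_bound)
  show "integrable lborel (\<lambda>y. C * indicator {a<..b} y)"
    by (rule cell_indicator_integrable)
  have "\<bar>u y\<bar> \<le> \<bar>C\<bar>" for y using C[of y] by linarith
  then show "AE y in lborel. norm (u y * indicator {a<..b} y) \<le> norm (C * indicator {a<..b} y)"
    by (simp add: abs_mult mult_right_mono)
qed measurable

lemma cell_integral_bump_limit:
  assumes [measurable]: "u \<in> borel_measurable borel" and C: "\<And>x. \<bar>u x\<bar> \<le> C"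
  shows "(\<lambda>n. \<integral>y. u y * bump a b (Suc n) y \<partial>lborel) \<longlonglongrightarrow> cell_integral u a b"
  unfolding cell_integral_def
proof (rule integral_dominated_convergence)
  show "integrable lborel (\<lambda>y. C * indicator {a<..b} y)"
    by (rule cell_indicator_integrable)
  show "AE y in lborel. (\<lambda>n. u y * bump a b (Suc n) y) \<longlonglongrightarrow> u y * indicator {a<..b} y"
    using AE_lborel_singleton[of b]
    by eventually_elim (intro tendsto_mult tendsto_const bump_tendsto)
  show "AE y in lborel. norm (u y * bump a b (Suc n) y) \<le> C * indicator {a<..b} y" for n
  proof (rule AE_I2)
    fix y
    have "0 \<le> C" using C[of y] by linarith
    then show "norm (u y * bump a b (Suc n) y) \<le> C * indicator {a<..b} y"
      unfolding real_norm_def abs_mult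
      using C[of y] bump_bounds[of "Suc n" a b y] by (intro mult_mono) auto
  qed
qed measurable

text \<open>Additivity gives g (n s) = n g s. Splitting (n + 1) t into integer and fractional part r
  leaves the error g r - r g 1, which is at most 2 C and disappears after division by n + 1.\<close>

lemma additive_bounded_linear:
  fixes g :: "real \<Rightarrow> real"
  assumes add: "\<And>s t. 0 \<le> s \<Longrightarrow> 0 \<le> t \<Longrightarrow> g (s + t) = g s + g t"
    and bd: "\<And>t. 0 \<le> t \<Longrightarrow> \<bar>g t\<bar> \<le> C * t" and t: "0 \<le> t"
  shows "g t = t * g 1"
proof -
  have mult: "g (real n * s) = real n * g s" if "0 \<le> s" for n s
  proof (induction n)
    case 0 then show ?case using bd[of 0] by simp
  next
    case (Suc n)
    have "g (real (Suc n) * s) = g (real n * s + s)" by (simp add: algebra_simps)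
    also have "\<dots> = g (real n * s) + g s" using that by (intro add) auto
    finally show ?case using Suc by (simp add: algebra_simps)
  qed
  have C: "0 \<le> C" using bd[of 1] by simp
  have "\<bar>g t - t * g 1\<bar> \<le> 2 * C / real (Suc n)" for n
  proof -
    let ?s = "real (Suc n) * t"
    define k where "k = nat \<lfloor>?s\<rfloor>"
    define r where "r = ?s - real k"
    have s: "0 \<le> ?s" using t by simp
    have r: "0 \<le> r" "r \<le> 1" using s unfolding r_def k_def by linarith+
    have "real (Suc n) * g t = g (real k * 1 + r)" using mult[OF t, of "Suc n"] by (simp add: r_def)
    also have "\<dots> = real k * g 1 + g r"
      using r by (subst add) (auto simp: mult[of 1, simplified])
    finally have "real (Suc n) * (g t - t * g 1) = g r - r * g 1"
      by (simp add: r_def algebra_simps)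
    also have "\<bar>\<dots>\<bar> \<le> C * r + r * (C * 1)"
      using bd[of r] bd[of 1] r by (intro order_trans[OF abs_triangle_ineq4] add_mono) 
        (auto simp: abs_mult intro!: mult_left_mono)
    also have "\<dots> \<le> 2 * C" using C r mult_left_mono[of r 1 C] by (simp add: algebra_simps)
    finally have "real (Suc n) * \<bar>g t - t * g 1\<bar> \<le> 2 * C"
      by (simp only: abs_mult abs_of_nat)
    then show ?thesis by (simp add: pos_le_divide_eq mult.commute del: of_nat_Suc)
  qed
  moreover have "(\<lambda>n. 2 * C / real (Suc n)) \<longlonglongrightarrow> 0" by real_asymp
  ultimately have "\<bar>g t - t * g 1\<bar> \<le> 0"
    by (intro LIMSEQ_le_const) auto
  then show ?thesis by simp
qed

text \<open>In the limit of steep bumps, the integral of u over a cell depends only on the length of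
  the cell; being additive and linearly bounded, it is a multiple m of the length. A normalised
  version of u is then a density of Lebesgue measure with respect to itself.\<close>

lemma AE_const_of_bump_invariance:
  fixes u :: "real \<Rightarrow> real"
  assumes u [measurable]: "u \<in> borel_measurable borel" and C: "\<And>x. \<bar>u x\<bar> \<le> C"
    and inv: "\<And>a b n x. a < b \<Longrightarrow>
      (\<integral>y. u y * bump a b (Suc n) (y - x) \<partial>lborel) = (\<integral>y. u y * bump a b (Suc n) y \<partial>lborel)"
  shows "\<exists>c. AE x in lborel. u x = c"
proof -
  let ?J = "cell_integral u"
  have J_shift: "?J (a + x) (b + x) = ?J a b" if "a < b" for a b x
    using cell_integral_bump_limit[OF u C, of a b] cell_integral_bump_limit[OF u C, of "a + x" "b + x"]
      inv[OF that, of _ x, unfolded bump_shift] by (simp add: LIMSEQ_unique)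
  have J_add: "?J a c = ?J a b + ?J b c" if "a \<le> b" "b \<le> c" for a b c
  proof -
    have "u y * indicator {a<..c} y = u y * indicator {a<..b} y + u y * indicator {b<..c} y" for y
      using that by (auto simp: indicator_def)
    then show ?thesis unfolding cell_integral_def
      by (simp add: Bochner_Integration.integral_add[OF cell_integrable[OF u C] cell_integrable[OF u C]])
  qed
  have J_bd: "\<bar>?J a b\<bar> \<le> C * (b - a)" if "a \<le> b" for a b
  proof -
    have "\<bar>?J a b\<bar> \<le> (\<integral>y. C * indicator {a<..b} y \<partial>lborel)"
      unfolding cell_integral_def real_norm_def[symmetric]
      using C by (intro Bochner_Integration.integral_norm_bound_integral cell_integrable[OF u C]
          cell_indicator_integrable) (simp add: abs_mult mult_right_mono)
    then show ?thesis using that by simp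
  qed
  have J_0: "?J a a = 0" for a by (simp add: cell_integral_def)
  define m where "m = ?J 0 1"
  have J_lin: "?J 0 t = t * m" if "0 \<le> t" for t
    unfolding m_def
  proof (rule additive_bounded_linear[where C = C])
    show "?J 0 (s + t) = ?J 0 s + ?J 0 t" if "0 \<le> s" "0 \<le> t" for s t
      using J_add[of 0 s "s + t"] J_shift[of 0 t s] that J_0 by (cases "t = 0") (auto simp: add.commute)
  qed (use J_bd[of 0] that in auto)
  have J: "?J a b = (b - a) * m" if "a \<le> b" for a b
    using J_shift[of 0 "b - a" a] J_lin[of "b - a"] that J_0 by (cases "a = b") auto
  have m: "\<bar>m\<bar> \<le> C" using J_bd[of 0 1] by (simp add: m_def)
  \<comment> \<open>Adding C + 1 makes the numerator at least 1; the denominator is also at least 1,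
    as |m| \<le> C, and it normalises the integral of f over an interval to the length.\<close>
  define f where "f y = (u y + C + 1) / (m + C + 1)" for y
  have [measurable]: "f \<in> borel_measurable borel" unfolding f_def by measurable
  have f0: "0 \<le> f y" for y
    using C[of y] m unfolding f_def by (intro divide_nonneg_pos) linarith+
  \<comment> \<open>Lebesgue measure is determined by its values on boxes; uniqueness of densities
    then forces f = 1 almost everywhere.\<close>
  have "lborel = density lborel f"
  proof (rule lborel_eqI)
    fix a b :: real assume "\<And>c. c \<in> Basis \<Longrightarrow> a \<bullet> c \<le> b \<bullet> c"
    then have ab: "a \<le> b" by simp
    have int: "integrable lborel (\<lambda>y. f y * indicator {a<..b} y)"
    proof (rule cell_integrable)
      fix y
      have "u y + C + 1 \<le> (u y + C + 1) * (m + C + 1)"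
      proof -
        have "1 \<le> m + C + 1" "0 \<le> u y + C + 1" using C[of y] m by linarith+
        from mult_left_mono[OF this] show ?thesis by simp
      qed
      then have "f y \<le> u y + C + 1"
        using m unfolding f_def by (subst pos_divide_le_eq) linarith+
      then show "\<bar>f y\<bar> \<le> 2 * C + 1" using f0[of y] C[of y] by linarith
    qed simp
    have "emeasure (density lborel f) (box a b) = (\<integral>\<^sup>+ y. ennreal (f y) * indicator (box a b) y \<partial>lborel)"
      by (simp add: emeasure_density)
    also have "\<dots> = (\<integral>\<^sup>+ y. ennreal (f y * indicator {a<..b} y) \<partial>lborel)"
    proof (rule nn_integral_cong_AE)
      show "AE y in lborel. ennreal (f y) * indicator (box a b) y = ennreal (f y * indicator {a<..b} y)"
        using AE_lborel_singleton[of b] by eventually_elim (auto simp: indicator_def box_real)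
    qed
    also have "\<dots> = ennreal (\<integral>y. f y * indicator {a<..b} y \<partial>lborel)"
      using f0 by (intro nn_integral_eq_integral int) auto
    also have "(\<integral>y. f y * indicator {a<..b} y \<partial>lborel)
        = (\<integral>y. (u y * indicator {a<..b} y + (C + 1) * indicator {a<..b} y) / (m + C + 1) \<partial>lborel)"
      by (simp add: f_def algebra_simps add_divide_distrib)
    also have "\<dots> = (?J a b + (C + 1) * (b - a)) / (m + C + 1)"
      using ab by (subst integral_divide_zero, subst Bochner_Integration.integral_add[OF cell_integrable[OF u C]])
        (auto simp: cell_integral_def intro!: integrable_real_indicator)
    also have "\<dots> = (b - a) * (m + C + 1) / (m + C + 1)"
      using J[OF ab] by (simp add: algebra_simps)
    also have "\<dots> = b - a" using m by simp
    finally show "emeasure (density lborel f) (box a b) = (\<Prod>c\<in>Basis. (b - a) \<bullet> c)" by simp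
  qed simp
  then have "density lborel (\<lambda>y. ennreal (f y)) = density lborel (\<lambda>_. 1)" by (simp add: density_1)
  then have "AE y in lborel. ennreal (f y) = 1"
    by (subst (asm) sigma_finite_measure.density_unique_iff[OF sigma_finite_lborel]) auto
  then have "AE y in lborel. u y = m"
  proof eventually_elim
    case (elim y)
    then have "f y = 1" using f0[of y] by (simp add: ennreal_eq_1)
    then show ?case using m unfolding f_def by (simp add: divide_eq_eq split: if_splits)
  qed
  then show ?thesis by blast
qed

section \<open>Bounded harmonic functions are periodic along the support\<close>

text \<open>Models the push-forward of a measure on the punctured line to the whole line, so that
  integrands are ordinary Borel functions; \<open>null_zero\<close> says that no mass is placed at
  0.\<close>

locale levy_measure =
  fixes \<nu> :: "real measure"
  assumes sets_nu [measurable_cong]: "sets \<nu> = sets borel"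
    and null_zero: "emeasure \<nu> {0} = 0"
    and moment: "(\<integral>\<^sup>+ z. ennreal (min (z\<^sup>2) 1) \<partial>\<nu>) < \<infinity>"
begin

lemma space_nu [simp]: "space \<nu> = UNIV"
  using sets_eq_imp_space_eq[OF sets_nu] by simp

text \<open>Markov's inequality for the function min (z^2) 1.\<close>

lemma emeasure_away_finite:
  assumes "0 < r"
  shows "emeasure \<nu> {z. r \<le> \<bar>z\<bar>} < \<infinity>"
proof -
  let ?c = "min (r\<^sup>2) 1"
  have c: "0 < ?c" using assms by simp
  have [measurable]: "{z. r \<le> \<bar>z\<bar>} \<in> sets \<nu>" unfolding sets_nu by measurable
  have "ennreal ?c * emeasure \<nu> {z. r \<le> \<bar>z\<bar>} = (\<integral>\<^sup>+ z. ennreal ?c * indicator {z. r \<le> \<bar>z\<bar>} z \<partial>\<nu>)"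
    by (simp add: nn_integral_cmult_indicator)
  also have "\<dots> \<le> (\<integral>\<^sup>+ z. ennreal (min (z\<^sup>2) 1) \<partial>\<nu>)"
  proof (intro nn_integral_mono)
    fix z
    have "r \<le> \<bar>z\<bar> \<Longrightarrow> r\<^sup>2 \<le> z\<^sup>2" using assms by (simp add: abs_le_square_iff[symmetric])
    then show "ennreal ?c * indicator {z. r \<le> \<bar>z\<bar>} z \<le> ennreal (min (z\<^sup>2) 1)"
      by (auto simp: indicator_def intro!: ennreal_leI)
  qed
  finally have "ennreal ?c * emeasure \<nu> {z. r \<le> \<bar>z\<bar>} < \<infinity>"
    using moment by (rule le_less_trans)
  then show ?thesis
    using c by (auto simp: ennreal_mult_less_top ennreal_eq_0_iff min_def split: if_splits)
qed

text \<open>The line is covered by {0} and the sets |z| \<ge> 1 / (n + 1), all of finite measure.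
  This is what Fubini requires.\<close>

sublocale sigma_finite_measure \<nu>
proof
  let ?A = "insert {0} (range (\<lambda>n. {z :: real. 1 / Suc n \<le> \<bar>z\<bar>}))"
  have "{z :: real. c \<le> \<bar>z\<bar>} \<in> sets borel" for c by measurable
  then have "?A \<subseteq> sets \<nu>" by (auto simp: sets_nu)
  moreover have "\<Union> ?A = space \<nu>"
  proof -
    have "x \<in> \<Union> ?A" for x
    proof (cases "x = 0")
      case False
      then obtain n where "inverse (Suc n) < \<bar>x\<bar>"
        using reals_Archimedean[of "\<bar>x\<bar>"] by auto
      then have "x \<in> {z. 1 / Suc n \<le> \<bar>z\<bar>}" by (simp add: inverse_eq_divide)
      then show ?thesis by blast
    qed auto
    then show ?thesis by auto
  qed
  moreover have "\<forall>a\<in>?A. emeasure \<nu> a \<noteq> \<infinity>"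
    using emeasure_away_finite null_zero by (auto simp: less_top[symmetric])
  moreover have "countable ?A" by simp
  ultimately show "\<exists>A. countable A \<and> A \<subseteq> sets \<nu> \<and> \<Union> A = space \<nu> \<and> (\<forall>a\<in>A. emeasure \<nu> a \<noteq> \<infinity>)"
    by blast
qed

sublocale lborel_nu: pair_sigma_finite lborel \<nu> ..

lemma moment_integrable: "integrable \<nu> (\<lambda>z. min (z\<^sup>2) 1)"
  using moment by (intro integrableI_bounded) (auto simp: abs_of_nonneg)

lemma integrable_of_moment_bound:
  assumes [measurable]: "g \<in> borel_measurable borel" and "\<And>z. \<bar>g z\<bar> \<le> K * min (z\<^sup>2) 1"
  shows "integrable \<nu> g"
proof (rule Bochner_Integration.integrable_bound)
  show "integrable \<nu> (\<lambda>z. K * min (z\<^sup>2) 1)" using moment_integrable by simp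
  have "\<bar>g z\<bar> \<le> \<bar>K * min (z\<^sup>2) 1\<bar>" for z using assms(2)[of z] by linarith
  then show "AE z in \<nu>. norm (g z) \<le> norm (K * min (z\<^sup>2) 1)" by simp
qed measurable

text \<open>Dominated convergence: the integrand over shrinking intervals tends to 0 pointwise, at z
  = 0 because the factor z^2 vanishes there.\<close>

lemma small_moment:
  assumes "0 < \<epsilon>" "0 < d"
  obtains \<delta> where "0 < \<delta>" "\<delta> < d" "(\<integral>z. indicator {-\<delta>..\<delta>} z * min (z\<^sup>2) 1 \<partial>\<nu>) < \<epsilon>"
proof -
  let ?s = "\<lambda>n. 1 / Suc n :: real"
  let ?g = "\<lambda>n z. indicator {- ?s n..?s n} z * min (z\<^sup>2) 1"
  have "(\<lambda>n. \<integral>z. ?g n z \<partial>\<nu>) \<longlonglongrightarrow> (\<integral>z. 0 \<partial>\<nu>)"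
  proof (rule integral_dominated_convergence[OF _ _ moment_integrable])
    show "AE z in \<nu>. (\<lambda>n. ?g n z) \<longlonglongrightarrow> 0"
    proof (rule AE_I2)
      fix z
      show "(\<lambda>n. ?g n z) \<longlonglongrightarrow> 0"
      proof (cases "z = 0")
        case False
        have "eventually (\<lambda>n. ?s n < \<bar>z\<bar>) sequentially"
          using False by real_asymp
        then have "eventually (\<lambda>n. ?g n z = 0) sequentially"
          by eventually_elim (auto simp: indicator_def)
        then show ?thesis by (rule tendsto_eventually)
      qed simp
    qed
  qed (auto simp: indicator_def)
  then have "eventually (\<lambda>n. (\<integral>z. ?g n z \<partial>\<nu>) < \<epsilon>) sequentially"
    using assms(1) by (simp add: order_tendstoD(2))
  moreover have "eventually (\<lambda>n. ?s n < d) sequentially"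
    using assms(2) by real_asymp
  ultimately have "eventually (\<lambda>n. (\<integral>z. ?g n z \<partial>\<nu>) < \<epsilon> \<and> ?s n < d) sequentially"
    by (rule eventually_conj)
  then obtain n where "(\<integral>z. ?g n z \<partial>\<nu>) < \<epsilon>" "?s n < d"
    using eventually_happens by force
  then show thesis by (intro that[of "?s n"]) auto
qed

text \<open>
  Quantitative propagation of the maximum; it replaces extracting a limit of translates at which the
  supremum is attained.
\<close>
lemma near_max_step:
  assumes "\<And>x. w x \<le> M" and lip: "\<And>x y. \<bar>w x - w y\<bar> \<le> L * \<bar>x - y\<bar>"
    and dom: "\<And>z x. \<bar>second_diff w z x\<bar> \<le> K * min (z\<^sup>2) 1"
    and meas [measurable]: "w \<in> borel_measurable borel"
    and harm: "\<And>x. (\<integral>z. second_diff w z x \<partial>\<nu>) = 0"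
    and h: "h \<noteq> 0" "\<And>r. 0 < r \<Longrightarrow> 0 < emeasure \<nu> (ball h r)"
    and \<epsilon>: "0 < \<epsilon>"
  obtains \<eta> where "0 < \<eta>" "\<And>x. M - \<eta> \<le> w x \<Longrightarrow> M - \<epsilon> \<le> w (x + h)"
proof -
  have L: "0 \<le> L" using lip[of 1 0] by simp
  have K: "0 \<le> K" using dom[of 1 0] by simp
  define d where "d = \<bar>h\<bar> / 2"
  have d: "0 < d" using h(1) by (simp add: d_def)
  \<comment> \<open>The ball of radius r about h stays at distance d from 0, and w varies by at most
    \<epsilon> / 2 between h-translates and points of the ball translated by x.\<close>
  define r where "r = min d (\<epsilon> / (2 * (L + 1)))"
  have r: "0 < r" using d \<epsilon> L by (simp add: r_def)
  have "(L + 1) * r \<le> (L + 1) * (\<epsilon> / (2 * (L + 1)))"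
    using L by (intro mult_left_mono) (auto simp: r_def)
  also have "\<dots> = \<epsilon> / 2" using L by (simp add: field_simps)
  finally have Lr: "L * r \<le> \<epsilon> / 2" using r by (simp add: algebra_simps)
  define A where "A = ball h r"
  define m where "m = measure \<nu> A"
  have far: "d \<le> \<bar>z\<bar>" if "z \<in> A" for z
  proof -
    have "\<bar>h - z\<bar> < d" using that by (simp add: A_def dist_real_def r_def)
    moreover have "\<bar>h\<bar> \<le> \<bar>h - z\<bar> + \<bar>z\<bar>" by linarith
    ultimately show ?thesis by (simp add: d_def)
  qed
  have [measurable]: "A \<in> sets borel" by (simp add: A_def)
  have fin: "emeasure \<nu> {z. \<delta> \<le> \<bar>z\<bar>} < \<infinity>" if "0 < \<delta>" for \<delta>
    using that by (rule emeasure_away_finite)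
  have A_fin: "emeasure \<nu> A < \<infinity>"
  proof -
    have "{z. d \<le> \<bar>z\<bar>} \<in> sets \<nu>" unfolding sets_nu by measurable
    then have "emeasure \<nu> A \<le> emeasure \<nu> {z. d \<le> \<bar>z\<bar>}"
      using far by (intro emeasure_mono) blast+
    then show ?thesis using fin[OF d] by (rule le_less_trans)
  qed
  have m: "0 < m"
    using h(2)[OF r] A_fin by (auto simp: m_def A_def measure_def enn2real_positive_iff)
  define p where "p = \<epsilon> * m"
  have p: "0 < p" using \<epsilon> m by (simp add: p_def)
  \<comment> \<open>The jumps within [-\<delta>, \<delta>] will contribute at most p / 8; K + 1
    avoids division by 0. Taking \<delta> < d keeps the ball about h inside
    \<open>F\<close>.\<close>
  have "0 < p / (8 * (K + 1))" using p K by simp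
  then obtain \<delta> where \<delta>: "0 < \<delta>" "\<delta> < d"
    "(\<integral>z. indicator {-\<delta>..\<delta>} z * min (z\<^sup>2) 1 \<partial>\<nu>) < p / (8 * (K + 1))" (is "?I < _")
    using small_moment d by metis
  define F where "F = {z. \<delta> \<le> \<bar>z\<bar>}"
  have [measurable]: "F \<in> sets borel" unfolding F_def by measurable
  have F_fin: "emeasure \<nu> F < \<infinity>" using fin[OF \<delta>(1)] by (simp add: F_def)
  define T where "T = measure \<nu> F"
  have T: "0 \<le> T" by (simp add: T_def)
  \<comment> \<open>Chosen after \<delta>, since it depends on the mass T of \<open>F\<close>: the
    jumps in \<open>F\<close> then contribute at most 2 \<eta> T \<le> p / 4.\<close>
  define \<eta> where "\<eta> = p / (8 * (T + 1))"
  have \<eta>: "0 < \<eta>" using p T by (simp add: \<eta>_def)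
  show thesis
  proof (rule that[OF \<eta>])
    fix x assume x: "M - \<eta> \<le> w x"
    show "M - \<epsilon> \<le> w (x + h)"
    proof (rule ccontr)
      assume "\<not> M - \<epsilon> \<le> w (x + h)"
      then have drop: "w (x + h) < M - \<epsilon>" by simp
      let ?q = "\<lambda>z. indicator {-\<delta>..\<delta>} z * min (z\<^sup>2) 1"
      \<comment> \<open>Majorant of the second difference: on \<open>F\<close> the two increments
        are at most \<eta> each, on the ball about h the assumed drop of w improves this by
        \<epsilon> / 2, and near 0 the bound \<open>dom\<close> takes over.\<close>
      let ?g = "\<lambda>z. - (\<epsilon> / 2) * indicator A z + 2 * \<eta> * indicator F z + K * ?q z"
      have le: "second_diff w z x \<le> ?g z" for z
      proof (cases "z \<in> F")
        case False
        then have "z \<in> {-\<delta>..\<delta>}" "z \<notin> A" using far[of z] \<delta> by (auto simp: F_def)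
        then show ?thesis using dom[of z x] False by (simp add: abs_le_iff)
      next
        case True
        have "0 \<le> K * ?q z" using K by simp
        moreover have "second_diff w z x \<le> - (\<epsilon> / 2) * indicator A z + 2 * \<eta>"
        proof (cases "z \<in> A")
          case zA: True
          have "w (x + z) \<le> w (x + h) + L * \<bar>z - h\<bar>"
            using lip[of "x + z" "x + h"] by simp
          also have "L * \<bar>z - h\<bar> \<le> L * r"
            using zA L by (intro mult_left_mono) (auto simp: A_def dist_real_def)
          finally show ?thesis
            using zA drop Lr x assms(1)[of "x - z"] unfolding second_diff_def by simp
        next
          case False
          have "second_diff w z x \<le> 2 * \<eta>"
            using assms(1)[of "x + z"] assms(1)[of "x - z"] x unfolding second_diff_def by linarith
          then show ?thesis using False by simp
        qed
        ultimately show ?thesis using True by simp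
      qed
      have intA: "integrable \<nu> (indicator A :: real \<Rightarrow> real)"
        and intF: "integrable \<nu> (indicator F :: real \<Rightarrow> real)"
        using A_fin F_fin by (auto intro!: integrable_real_indicator simp: sets_nu)
      have intq: "integrable \<nu> ?q"
        by (rule integrable_of_moment_bound[of _ 1]) (auto simp: indicator_def)
      have "0 = (\<integral>z. second_diff w z x \<partial>\<nu>)" using harm by simp
      also have "\<dots> \<le> (\<integral>z. ?g z \<partial>\<nu>)"
      proof (rule integral_mono)
        show "integrable \<nu> (\<lambda>z. second_diff w z x)"
          by (rule integrable_of_moment_bound[OF _ dom]) (simp add: second_diff_def)
        show "integrable \<nu> ?g"
          using intA intF intq by (intro Bochner_Integration.integrable_add integrable_mult_right)
      qed (rule le)
      also have "\<dots> = - (\<epsilon> / 2) * m + 2 * \<eta> * T + K * ?I"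
        using intA intF intq by (simp add: m_def T_def sets_nu)
      \<comment> \<open>The gain is p / 2, the two losses are at most p / 4 and p / 8.\<close>
      also have "\<dots> < 0"
      proof -
        have "K * ?I \<le> K * (p / (8 * (K + 1)))"
          using \<delta>(3) K by (intro mult_left_mono) auto
        also have "\<dots> \<le> p / 8" using K p by (simp add: field_simps)
        finally have 1: "K * ?I \<le> p / 8" .
        have 2: "2 * \<eta> * T \<le> p / 4" using T p by (simp add: \<eta>_def field_simps)
        show ?thesis using 1 2 p by (simp add: p_def)
      qed
      finally show False by simp
    qed
  qed
qed

text \<open>Tolerances are chosen backwards from the last step: the one needed for the final
  translation by h becomes the target of the induction hypothesis.\<close>

lemma near_max_iterate:
  assumes "\<And>x. w x \<le> M" "\<And>x y. \<bar>w x - w y\<bar> \<le> L * \<bar>x - y\<bar>"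
    "\<And>z x. \<bar>second_diff w z x\<bar> \<le> K * min (z\<^sup>2) 1"
    "w \<in> borel_measurable borel"
    "\<And>x. (\<integral>z. second_diff w z x \<partial>\<nu>) = 0"
    "h \<noteq> 0" "\<And>r. 0 < r \<Longrightarrow> 0 < emeasure \<nu> (ball h r)" "0 < \<epsilon>"
  shows "\<exists>\<eta>>0. \<forall>x. M - \<eta> \<le> w x \<longrightarrow> (\<forall>k\<le>N. M - \<epsilon> \<le> w (x + real k * h))"
  using assms(8)
proof (induction N arbitrary: \<epsilon>)
  case 0
  then show ?case by (intro exI[of _ \<epsilon>]) auto
next
  case (Suc N)
  obtain \<zeta> where \<zeta>: "0 < \<zeta>" "\<And>x. M - \<zeta> \<le> w x \<Longrightarrow> M - \<epsilon> \<le> w (x + h)"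
    using near_max_step[OF assms(1-7) Suc.prems] by metis
  \<comment> \<open>The minimum serves two purposes: \<epsilon> is the claim for k \<le> N, and
    \<zeta> permits one more step from x + N h.\<close>
  have "0 < min \<epsilon> \<zeta>" using Suc.prems \<zeta>(1) by simp
  then obtain \<eta> where \<eta>: "0 < \<eta>"
    "\<And>x k. M - \<eta> \<le> w x \<Longrightarrow> k \<le> N \<Longrightarrow> M - min \<epsilon> \<zeta> \<le> w (x + real k * h)"
    using Suc.IH by metis
  show ?case
  proof (intro exI[of _ \<eta>] conjI allI impI \<eta>(1))
    fix x k assume x: "M - \<eta> \<le> w x" and k: "k \<le> Suc N"
    show "M - \<epsilon> \<le> w (x + real k * h)"
    proof (cases "k = Suc N")
      case True
      have "M - \<zeta> \<le> w (x + real N * h)" using \<eta>(2)[OF x, of N] by simp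
      from \<zeta>(2)[OF this] show ?thesis using True by (simp add: algebra_simps)
    next
      case False
      then show ?thesis using \<eta>(2)[OF x, of k] k by simp
    qed
  qed
qed

text \<open>If the increment w x = v (x + h) - v x had a supremum M > 0, a long run of increments
  along x, x + h, x + 2 h, ... would each be at least M / 2, and their sum would exceed the
  oscillation 2 C of v.\<close>

lemma harmonic_shift_le:
  assumes bd: "\<And>x. \<bar>v x\<bar> \<le> C" and lip: "\<And>x y. \<bar>v x - v y\<bar> \<le> L * \<bar>x - y\<bar>"
    and dom: "\<And>z x. \<bar>second_diff v z x\<bar> \<le> K * min (z\<^sup>2) 1"
    and meas [measurable]: "v \<in> borel_measurable borel"
    and harm: "\<And>x. (\<integral>z. second_diff v z x \<partial>\<nu>) = 0"
    and h: "h \<noteq> 0" "\<And>r. 0 < r \<Longrightarrow> 0 < emeasure \<nu> (ball h r)"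
  shows "v (x + h) \<le> v x"
proof (rule ccontr)
  assume "\<not> v (x + h) \<le> v x"
  define w where "w x = v (x + h) - v x" for x
  have w_bd: "w x \<le> 2 * C" for x using bd[of x] bd[of "x + h"] unfolding w_def by linarith
  define M where "M = (SUP x. w x)"
  have bdd: "bdd_above (range w)" by (rule bdd_aboveI2[of _ w "2 * C"]) (rule w_bd)
  have wM: "w x \<le> M" for x unfolding M_def by (rule cSUP_upper[OF _ bdd]) simp
  have "0 < w x" using \<open>\<not> v (x + h) \<le> v x\<close> by (simp add: w_def)
  then have M: "0 < M" using wM[of x] by simp
  \<comment> \<open>Second differences commute with translation, so w inherits the bounds and the
    equation from v.\<close>
  have sd: "second_diff w z x = second_diff v z (x + h) - second_diff v z x" for z x
    by (simp add: second_diff_def w_def algebra_simps)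
  have w_lip: "\<bar>w x - w y\<bar> \<le> (2 * L) * \<bar>x - y\<bar>" for x y
    using lip[of "x + h" "y + h"] lip[of x y] by (simp add: w_def)
  have w_dom: "\<bar>second_diff w z x\<bar> \<le> (2 * K) * min (z\<^sup>2) 1" for z x
    using dom[of z x] dom[of z "x + h"] unfolding sd by linarith
  have w_meas: "w \<in> borel_measurable borel" unfolding w_def by measurable
  have w_harm: "(\<integral>z. second_diff w z x \<partial>\<nu>) = 0" for x
  proof -
    have "integrable \<nu> (\<lambda>z. second_diff v z y)" for y
      by (rule integrable_of_moment_bound[OF _ dom]) (simp add: second_diff_def)
    then show ?thesis unfolding sd by (simp add: harm)
  qed
  obtain N where N: "2 * C < real (Suc N) * (M / 2)"
  proof -
    obtain n where n: "4 * C / M < real n" using reals_Archimedean2 by blast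
    then have "4 * C < real n * M" using M by (simp only: pos_divide_less_eq)
    then have "2 * C < real n * (M / 2)" by simp
    also have "\<dots> \<le> real (Suc n) * (M / 2)" using M by (intro mult_right_mono) auto
    finally show thesis by (rule that)
  qed
  obtain \<eta> where \<eta>: "0 < \<eta>"
      "\<And>x k. M - \<eta> \<le> w x \<Longrightarrow> k \<le> N \<Longrightarrow> M - M / 2 \<le> w (x + real k * h)"
  proof -
    have "0 < M / 2" using M by simp
    from near_max_iterate[OF wM w_lip w_dom w_meas w_harm h this, of N] show thesis
      using that by blast
  qed
  obtain y where y: "M - \<eta> < w y"
  proof -
    have "M - \<eta> < (SUP x. w x)" using \<eta>(1) unfolding M_def by simp
    then show thesis using less_cSUP_iff[OF UNIV_not_empty bdd] that by blast
  qed
  have "real (Suc N) * (M / 2) = (\<Sum>k<Suc N. M / 2)" by simp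
  also have "\<dots> \<le> (\<Sum>k<Suc N. w (y + real k * h))"
    using \<eta>(2)[of y] y by (intro sum_mono) (auto simp: less_Suc_eq_le)
  also have "\<dots> = (\<Sum>k<Suc N. v (y + real (Suc k) * h) - v (y + real k * h))"
    by (intro sum.cong) (auto simp: w_def algebra_simps)
  also have "\<dots> = v (y + real (Suc N) * h) - v y"
    by (subst sum_lessThan_telescope) simp
  also have "\<dots> \<le> 2 * C" using bd[of y] bd[of "y + real (Suc N) * h"] by linarith
  finally show False using N by simp
qed

lemma harmonic_periodic:
  assumes "\<And>x. \<bar>v x\<bar> \<le> C" "\<And>x y. \<bar>v x - v y\<bar> \<le> L * \<bar>x - y\<bar>"
    and "\<And>z x. \<bar>second_diff v z x\<bar> \<le> K * min (z\<^sup>2) 1"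
    and [measurable]: "v \<in> borel_measurable borel"
    and "\<And>x. (\<integral>z. second_diff v z x \<partial>\<nu>) = 0"
    and "h \<noteq> 0" "\<And>r. 0 < r \<Longrightarrow> 0 < emeasure \<nu> (ball h r)"
  shows "v (x + h) = v x"
proof (rule antisym)
  show "v (x + h) \<le> v x" by (rule harmonic_shift_le[OF assms])
  have sd: "second_diff (\<lambda>x. - v x) z x = - second_diff v z x" for z x
    by (simp add: second_diff_def)
  \<comment> \<open>The hypotheses are invariant under negation, which gives the reverse
    inequality.\<close>
  have "- v (x + h) \<le> - v x"
  proof (rule harmonic_shift_le[of "\<lambda>x. - v x" C L K h x, OF _ _ _ _ _ assms(6,7)])
    show "\<bar>- v x - - v y\<bar> \<le> L * \<bar>x - y\<bar>" for x y using assms(2)[of x y] by simp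
  qed (simp_all add: sd assms(1,3,5))
  then show "v x \<le> v (x + h)" by simp
qed

text \<open>Tonelli with the x integral inside: it is bounded by a multiple of min (z^2) 1, which
  the moment condition integrates.\<close>

lemma test_fubini_integrable:
  assumes f: "tame R K f" and u [measurable]: "u \<in> borel_measurable borel" and C: "\<And>x. \<bar>u x\<bar> \<le> C"
  shows "integrable (lborel \<Otimes>\<^sub>M \<nu>) (\<lambda>(x, z). u x * second_diff f z x)"
proof (rule integrableI_bounded)
  have [measurable]: "f \<in> borel_measurable borel" using f by (rule tame_borel)
  show meas [measurable]: "(\<lambda>(x, z). u x * second_diff f z x) \<in> borel_measurable (lborel \<Otimes>\<^sub>M \<nu>)"
    unfolding second_diff_def by measurable
  have C0: "0 \<le> C" using C[of 0] by simp
  have "(\<integral>\<^sup>+ p. ennreal (norm (case p of (x, z) \<Rightarrow> u x * second_diff f z x)) \<partial>(lborel \<Otimes>\<^sub>M \<nu>))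
      = (\<integral>\<^sup>+ z. (\<integral>\<^sup>+ x. ennreal \<bar>u x * second_diff f z x\<bar> \<partial>lborel) \<partial>\<nu>)"
    by (subst lborel_nu.nn_integral_snd[symmetric]) auto
  also have "\<dots> \<le> (\<integral>\<^sup>+ z. ennreal C * ennreal (8 * (R + 1) * K * min (z\<^sup>2) 1) \<partial>\<nu>)"
  proof (rule nn_integral_mono)
    fix z
    have "(\<integral>\<^sup>+ x. ennreal \<bar>u x * second_diff f z x\<bar> \<partial>lborel)
        \<le> (\<integral>\<^sup>+ x. ennreal C * ennreal \<bar>second_diff f z x\<bar> \<partial>lborel)"
      using C C0 by (intro nn_integral_mono) (simp add: abs_mult mult_right_mono flip: ennreal_mult)
    also have "\<dots> = ennreal C * (\<integral>\<^sup>+ x. ennreal \<bar>second_diff f z x\<bar> \<partial>lborel)"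
      unfolding second_diff_def by (rule nn_integral_cmult) measurable
    also have "\<dots> \<le> ennreal C * ennreal (8 * (R + 1) * K * min (z\<^sup>2) 1)"
      by (intro mult_left_mono tame_second_diff_integral[OF f]) simp
    finally show "(\<integral>\<^sup>+ x. ennreal \<bar>u x * second_diff f z x\<bar> \<partial>lborel) \<le> \<dots>" .
  qed
  also have "\<dots> = ennreal (C * (8 * (R + 1) * K)) * (\<integral>\<^sup>+ z. ennreal (min (z\<^sup>2) 1) \<partial>\<nu>)"
    using f C0 unfolding tame_def
    by (subst nn_integral_cmult[symmetric]) (auto simp: mult.assoc intro!: nn_integral_cong simp flip: ennreal_mult)
  also have "\<dots> < \<infinity>" using moment by (simp add: ennreal_mult_less_top)
  finally show "(\<integral>\<^sup>+ p. ennreal (norm (case p of (x, z) \<Rightarrow> u x * second_diff f z x)) \<partial>(lborel \<Otimes>\<^sub>M \<nu>)) < \<infinity>" .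
qed

lemma test_fubini:
  assumes "tame R K f" "u \<in> borel_measurable borel" "\<And>x. \<bar>u x\<bar> \<le> C"
  shows "(\<integral>x. u x * (\<integral>z. second_diff f z x \<partial>\<nu>) \<partial>lborel)
    = (\<integral>z. (\<integral>x. u x * second_diff f z x \<partial>lborel) \<partial>\<nu>)"
  using lborel_nu.Fubini_integral[OF test_fubini_integrable[OF assms]] by simp

end

section \<open>Correlations of bounded functions with test functions\<close>

lemma weighted_integral:
  fixes u g :: "real \<Rightarrow> real"
  assumes [measurable]: "u \<in> borel_measurable borel" "g \<in> borel_measurable borel"
    and C: "\<And>x. \<bar>u x\<bar> \<le> C" and B: "(\<integral>\<^sup>+ x. ennreal \<bar>g x\<bar> \<partial>lborel) \<le> ennreal B" "0 \<le> B"
  shows weighted_integrable: "integrable lborel (\<lambda>x. u x * g x)"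
    and weighted_integral_bound: "\<bar>\<integral>x. u x * g x \<partial>lborel\<bar> \<le> C * B"
proof -
  have C0: "0 \<le> C" using C[of 0] by simp
  have "(\<integral>\<^sup>+ x. ennreal (norm (u x * g x)) \<partial>lborel) \<le> (\<integral>\<^sup>+ x. ennreal C * ennreal \<bar>g x\<bar> \<partial>lborel)"
    using C C0 by (intro nn_integral_mono) (simp add: abs_mult mult_right_mono flip: ennreal_mult)
  also have "\<dots> = ennreal C * (\<integral>\<^sup>+ x. ennreal \<bar>g x\<bar> \<partial>lborel)"
    by (rule nn_integral_cmult) measurable
  also have "\<dots> \<le> ennreal C * ennreal B" by (intro mult_left_mono B) simp
  also have "\<dots> = ennreal (C * B)" using C0 B by (simp add: ennreal_mult)
  finally have le: "(\<integral>\<^sup>+ x. ennreal (norm (u x * g x)) \<partial>lborel) \<le> ennreal (C * B)" .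
  show int: "integrable lborel (\<lambda>x. u x * g x)"
    by (rule integrableI_bounded) (use le_less_trans[OF le] in auto)
  have "ennreal \<bar>\<integral>x. u x * g x \<partial>lborel\<bar> \<le> ennreal (C * B)"
    using integral_norm_bound_ennreal[OF int] le by (auto intro: order_trans)
  then show "\<bar>\<integral>x. u x * g x \<partial>lborel\<bar> \<le> C * B"
    using C0 B by (simp add: ennreal_le_iff)
qed

text \<open>The convolution of u with the reflection of f.\<close>

definition correlation :: "(real \<Rightarrow> real) \<Rightarrow> (real \<Rightarrow> real) \<Rightarrow> real \<Rightarrow> real" where
  "correlation u f x = (\<integral>y. u y * f (y - x) \<partial>lborel)"

lemma second_diff_shift: "second_diff (\<lambda>y. f (y - x)) z y = second_diff f z (y - x)"
proof -
  have "y + z - x = y - x + z" "y - z - x = y - x - z" by simp_all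
  then show ?thesis by (simp only: second_diff_def)
qed

locale bounded_times_tame =
  fixes u f :: "real \<Rightarrow> real" and C R K :: real
  assumes u_borel [measurable]: "u \<in> borel_measurable borel" and u_bound: "\<And>x. \<bar>u x\<bar> \<le> C"
    and tame: "tame R K f"
begin

lemma f_borel [measurable]: "f \<in> borel_measurable borel"
  using tame by (rule tame_borel)

lemma constants: "0 < R" "0 \<le> K" "0 \<le> C"
  using tame u_bound[of 0] by (auto simp: tame_def)

lemma shift_integral: "(\<integral>\<^sup>+ y. ennreal \<bar>f (y + t)\<bar> \<partial>lborel) \<le> ennreal (K * (2 * R))"
  using tame by (rule tame_integral)

lemma product_integrable: "integrable lborel (\<lambda>y. u y * f (y + t))"
  by (rule weighted_integrable[OF _ _ u_bound shift_integral]) (use constants in auto)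

lemma correlation_bound: "\<bar>correlation u f x\<bar> \<le> C * (K * (2 * R))"
  unfolding correlation_def
  using weighted_integral_bound[OF _ _ u_bound shift_integral[of "- x"]] constants by simp

text \<open>Two translates of f differ by at most K |x - x'|, and only on the union of two intervals
  of length 2 R; the sum of the two indicators majorises that of the union.\<close>

lemma correlation_lipschitz:
  "\<bar>correlation u f x - correlation u f x'\<bar> \<le> (C * (4 * R * K)) * \<bar>x - x'\<bar>"
proof -
  let ?g = "\<lambda>y. f (y - x) - f (y - x')"
  have "(\<integral>\<^sup>+ y. ennreal \<bar>?g y\<bar> \<partial>lborel)
      \<le> (\<integral>\<^sup>+ y. ennreal (K * \<bar>x - x'\<bar>) * (indicator {x - R..x + R} y + indicator {x' - R..x' + R} y) \<partial>lborel)"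
  proof (rule nn_integral_mono)
    fix y
    have lip: "\<bar>?g y\<bar> \<le> K * \<bar>x - x'\<bar>"
      using tame unfolding tame_def by (metis abs_minus_commute diff_diff_eq2 add.commute add_diff_cancel_left diff_add_cancel)
    show "ennreal \<bar>?g y\<bar> \<le> ennreal (K * \<bar>x - x'\<bar>) * (indicator {x - R..x + R} y + indicator {x' - R..x' + R} y)"
    proof (cases "y \<in> {x - R..x + R} \<or> y \<in> {x' - R..x' + R}")
      case True
      then have "1 \<le> (indicator {x - R..x + R} y + indicator {x' - R..x' + R} y :: ennreal)"
        by (auto simp: indicator_def)
      then have "ennreal (K * \<bar>x - x'\<bar>) * 1
          \<le> ennreal (K * \<bar>x - x'\<bar>) * (indicator {x - R..x + R} y + indicator {x' - R..x' + R} y)"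
        by (rule mult_left_mono) simp
      then show ?thesis using ennreal_leI[OF lip] by simp
    next
      case False
      then have "\<bar>y - x\<bar> > R" "\<bar>y - x'\<bar> > R" by auto
      then have "f (y - x) = 0" "f (y - x') = 0" using tame by (auto simp: tame_def)
      then show ?thesis by simp
    qed
  qed
  also have "\<dots> = ennreal (K * \<bar>x - x'\<bar>) * (ennreal (2 * R) + ennreal (2 * R))"
    using constants by (subst nn_integral_cmult) (simp_all add: nn_integral_add)
  also have "\<dots> = ennreal (4 * R * K * \<bar>x - x'\<bar>)"
    using constants by (simp add: ennreal_mult'' mult_ac flip: ennreal_plus ennreal_mult'')
  finally have le: "(\<integral>\<^sup>+ y. ennreal \<bar>?g y\<bar> \<partial>lborel) \<le> ennreal (4 * R * K * \<bar>x - x'\<bar>)" .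
  have "correlation u f x - correlation u f x' = (\<integral>y. u y * f (y - x) - u y * f (y - x') \<partial>lborel)"
    unfolding correlation_def
    using product_integrable[of "- x"] product_integrable[of "- x'"] by simp
  also have "\<dots> = (\<integral>y. u y * ?g y \<partial>lborel)" by (simp add: right_diff_distrib)
  finally have "correlation u f x - correlation u f x' = (\<integral>y. u y * ?g y \<partial>lborel)" .
  then have "\<bar>correlation u f x - correlation u f x'\<bar> \<le> C * (4 * R * K * \<bar>x - x'\<bar>)"
    using weighted_integral_bound[OF _ _ u_bound le] constants by simp
  then show ?thesis by (simp only: mult.assoc)
qed

lemma correlation_borel: "correlation u f \<in> borel_measurable borel"
proof (rule borel_measurable_continuous_onI)
  have "(C * (4 * R * K))-lipschitz_on UNIV (correlation u f)"
    using correlation_lipschitz constants by (intro lipschitz_onI) (auto simp: dist_real_def)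
  then show "continuous_on UNIV (correlation u f)" by (rule lipschitz_on_continuous_on)
qed

text \<open>Moving the difference onto the test function turns z into -z, and second differences are
  even in z.\<close>

lemma second_diff_correlation:
  "second_diff (correlation u f) z x = (\<integral>y. u y * second_diff (\<lambda>y. f (y - x)) z y \<partial>lborel)"
proof -
  have int: "integrable lborel (\<lambda>y. u y * f (y - t))" for t
    using product_integrable[of "- t"] by simp
  have "y + z - x = y - (x - z)" "y - z - x = y - (x + z)" for y by simp_all
  then have "(\<integral>y. u y * second_diff (\<lambda>y. f (y - x)) z y \<partial>lborel)
      = (\<integral>y. u y * f (y - (x - z)) + u y * f (y - (x + z)) - 2 * (u y * f (y - x)) \<partial>lborel)"
    unfolding second_diff_def by (intro Bochner_Integration.integral_cong) (simp_all add: algebra_simps)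
  also have "\<dots> = correlation u f (x - z) + correlation u f (x + z) - 2 * correlation u f x"
    unfolding correlation_def
    by (subst Bochner_Integration.integral_diff Bochner_Integration.integral_add integral_mult_right_zero;
        (intro int Bochner_Integration.integrable_add integrable_mult_right)?)+ (rule refl)
  finally show ?thesis by (simp add: second_diff_def)
qed

lemma second_diff_correlation_bound:
  "\<bar>second_diff (correlation u f) z x\<bar> \<le> (C * (8 * (R + 1) * K)) * min (z\<^sup>2) 1"
proof -
  have [measurable]: "second_diff f z \<in> borel_measurable borel"
    unfolding second_diff_def[abs_def] by measurable
  have "(\<integral>\<^sup>+ y. ennreal \<bar>second_diff f z (y - x)\<bar> \<partial>lborel) = (\<integral>\<^sup>+ y. ennreal \<bar>second_diff f z y\<bar> \<partial>lborel)"
    using nn_integral_real_affine[of "\<lambda>y. ennreal \<bar>second_diff f z y\<bar>" 1 "- x"] by simp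
  also have "\<dots> \<le> ennreal (8 * (R + 1) * K * min (z\<^sup>2) 1)"
    using tame by (rule tame_second_diff_integral)
  finally have "\<bar>\<integral>y. u y * second_diff f z (y - x) \<partial>lborel\<bar> \<le> C * (8 * (R + 1) * K * min (z\<^sup>2) 1)"
    by (intro weighted_integral_bound u_bound) (use constants in auto)
  then show ?thesis
    by (simp only: second_diff_correlation second_diff_shift mult.assoc)
qed

text \<open>A change of variables by a period of u shows that both translates of f have the same
  integral against u as f itself.\<close>

lemma second_diff_integral_periodic:
  assumes "\<And>x. u (x + z) = u x"
  shows "(\<integral>x. u x * second_diff f z x \<partial>lborel) = 0"
proof -
  have shift: "(\<integral>x. u x * f (x + t) \<partial>lborel) = (\<integral>x. u x * f x \<partial>lborel)" if "\<And>x. u (x + t) = u x" for t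
    using lborel_integral_real_affine[of 1 "\<lambda>x. u x * f x" t] that by (simp add: add.commute)
  have "u (x + (- z)) = u x" for x using assms[of "x - z"] by simp
  then have 1: "(\<integral>x. u x * f (x + - z) \<partial>lborel) = (\<integral>x. u x * f x \<partial>lborel)" by (rule shift)
  have 2: "(\<integral>x. u x * f (x + z) \<partial>lborel) = (\<integral>x. u x * f x \<partial>lborel)" using assms by (rule shift)
  have "(\<integral>x. u x * second_diff f z x \<partial>lborel)
      = (\<integral>x. u x * f (x + z) + u x * f (x + - z) - 2 * (u x * f (x + 0)) \<partial>lborel)"
    by (intro Bochner_Integration.integral_cong) (simp_all add: second_diff_def algebra_simps)
  also have "\<dots> = (\<integral>x. u x * f (x + z) \<partial>lborel) + (\<integral>x. u x * f (x + - z) \<partial>lborel)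
      - 2 * (\<integral>x. u x * f (x + 0) \<partial>lborel)"
    by (subst Bochner_Integration.integral_diff Bochner_Integration.integral_add integral_mult_right_zero;
        (intro product_integrable Bochner_Integration.integrable_add integrable_mult_right)?)+ (rule refl)
  also have "\<dots> = 0" unfolding 1 2 by simp
  finally show ?thesis .
qed

end

section \<open>Weak harmonicity and periods\<close>

context levy_measure
begin

text \<open>Testing the weak equation with the translate of f by x and exchanging the integrals
  gives the pointwise equation for the correlation at x, to which the maximum argument
  applies.\<close>

lemma correlation_periodic:
  assumes "bounded_times_tame u f C R K"
    and harm: "\<And>\<psi>. \<psi> \<in> test_functions \<Longrightarrow> (\<integral>x. u x * (\<integral>z. second_diff \<psi> z x \<partial>\<nu>) \<partial>lborel) = 0"
    and shifts: "\<And>x. (\<lambda>y. f (y - x)) \<in> test_functions"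
    and h: "h \<noteq> 0" "\<And>r. 0 < r \<Longrightarrow> 0 < emeasure \<nu> (ball h r)"
  shows "correlation u f (x + h) = correlation u f x"
proof -
  interpret bounded_times_tame u f C R K by fact
  have "(\<integral>z. second_diff (correlation u f) z x \<partial>\<nu>) = 0" for x
  proof -
    obtain R' K' where t: "tame R' K' (\<lambda>y. f (y - x))"
      using test_function_tame[OF shifts] by blast
    show ?thesis
      using harm[OF shifts[of x]] test_fubini[OF t u_borel u_bound]
      by (simp only: second_diff_correlation)
  qed
  then show ?thesis
    by (rule harmonic_periodic[OF correlation_bound correlation_lipschitz
        second_diff_correlation_bound correlation_borel _ h])
qed

text \<open>After Fubini the inner integral vanishes for almost every z. This provides the
  counterexample when the support lies in a lattice.\<close>

lemma periodic_weakly_harmonic: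
  assumes "bounded_times_tame u f C R K" and "AE z in \<nu>. \<forall>x. u (x + z) = u x"
  shows "(\<integral>x. u x * (\<integral>z. second_diff f z x \<partial>\<nu>) \<partial>lborel) = 0"
proof -
  interpret bounded_times_tame u f C R K by fact
  have "(\<integral>x. u x * (\<integral>z. second_diff f z x \<partial>\<nu>) \<partial>lborel)
      = (\<integral>z. (\<integral>x. u x * second_diff f z x \<partial>lborel) \<partial>\<nu>)"
    by (rule test_fubini[OF tame u_borel u_bound])
  also have "\<dots> = 0"
    using assms(2) by (intro integral_eq_zero_AE) (auto elim!: eventually_mono intro: second_diff_integral_periodic)
  finally show ?thesis .
qed

text \<open>The complement of the support is covered by null balls, and by Lindelof countably many
  of them suffice.\<close>

lemma AE_support: "AE z in \<nu>. z \<noteq> 0 \<and> (\<forall>r>0. 0 < emeasure \<nu> (ball z r))"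
proof -
  let ?F = "{ball z r | z r. emeasure \<nu> (ball z r) = 0}"
  obtain F where F: "F \<subseteq> ?F" "countable F" "\<Union> F = \<Union> ?F"
  proof -
    have "\<And>B. B \<in> ?F \<Longrightarrow> open B" by auto
    from Lindelof[OF this] that show thesis by blast
  qed
  have "(\<Union>B\<in>F. B) \<in> null_sets \<nu>"
    using F(1,2) by (intro null_sets_UN') (auto simp: null_sets_def sets_nu)
  then have "\<Union> ?F \<in> null_sets \<nu>" using F(3) by simp
  then have "\<Union> ?F \<union> {0} \<in> null_sets \<nu>"
    using null_zero by (intro null_sets.Un) (auto simp: null_sets_def sets_nu)
  then show ?thesis
  proof (rule AE_I')
    show "{z \<in> space \<nu>. \<not> (z \<noteq> 0 \<and> (\<forall>r>0. 0 < emeasure \<nu> (ball z r)))} \<subseteq> \<Union> ?F \<union> {0}"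
    proof
      fix z assume "z \<in> {z \<in> space \<nu>. \<not> (z \<noteq> 0 \<and> (\<forall>r>0. 0 < emeasure \<nu> (ball z r)))}"
      then have "z = 0 \<or> (\<exists>r>0. emeasure \<nu> (ball z r) = 0)" by (auto simp: zero_less_iff_neq_zero)
      then show "z \<in> \<Union> ?F \<union> {0}" using centre_in_ball by blast
    qed
  qed
qed

end

section \<open>Small periods and denominators\<close>

lemma int_multiple_period:
  fixes g :: "real \<Rightarrow> real"
  assumes "\<And>x. g (x + t) = g x"
  shows "g (x + of_int k * t) = g x"
proof -
  have nat: "g (x + real n * t) = g x" for n x
  proof (induction n)
    case (Suc n)
    then show ?case using assms[of "x + real n * t"] by (simp add: algebra_simps)
  qed simp
  show ?thesis
  proof (cases "0 \<le> k")
    case True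
    then show ?thesis using nat[of x "nat k"] by simp
  next
    case False
    then show ?thesis using nat[of "x + of_int k * t" "nat (- k)"] by simp
  qed
qed

text \<open>Integer multiples of a period t move y to within |t| of x without changing the value of
  g.\<close>

lemma lipschitz_small_periods_const:
  fixes g :: "real \<Rightarrow> real"
  assumes lip: "\<And>x y. \<bar>g x - g y\<bar> \<le> L * \<bar>x - y\<bar>"
    and small: "\<And>e. 0 < e \<Longrightarrow> \<exists>t. 0 < \<bar>t\<bar> \<and> \<bar>t\<bar> < e \<and> (\<forall>x. g (x + t) = g x)"
  shows "g x = g y"
proof -
  have L: "0 \<le> L" using lip[of 1 0] by simp
  have "\<bar>g x - g y\<bar> \<le> L * e" if "0 < e" for e
  proof -
    obtain t where t: "0 < \<bar>t\<bar>" "\<bar>t\<bar> < e" "\<And>x. g (x + t) = g x" using small[OF \<open>0 < e\<close>] by blast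
    define k where "k = \<lfloor>(x - y) / t\<rfloor>"
    have "\<bar>(x - y) / t - of_int k\<bar> \<le> 1" unfolding k_def by linarith
    then have "\<bar>t\<bar> * \<bar>(x - y) / t - of_int k\<bar> \<le> \<bar>t\<bar> * 1" by (intro mult_left_mono) auto
    moreover have "t * ((x - y) / t - of_int k) = x - (y + of_int k * t)"
    proof -
      have "t * ((x - y) / t) = x - y" using t(1) by simp
      then show ?thesis by (simp only: right_diff_distrib mult.commute[of t "of_int k"] diff_diff_eq)
    qed
    ultimately have "\<bar>x - (y + of_int k * t)\<bar> \<le> \<bar>t\<bar>"
      by (metis abs_mult mult.right_neutral)
    then have "\<bar>g x - g (y + of_int k * t)\<bar> \<le> L * e"
      using lip[of x "y + of_int k * t"] L t(2) mult_left_mono[of "\<bar>x - (y + of_int k * t)\<bar>" e L] by linarith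
    then show ?thesis using int_multiple_period[of g t, OF t(3)] by simp
  qed
  note le = this
  have "\<bar>g x - g y\<bar> \<le> 0 + e" if "0 < e" for e
  proof -
    have "\<bar>g x - g y\<bar> \<le> L * (e / (L + 1))" using that L by (intro le) simp
    also have "\<dots> \<le> e" using that L by (simp add: pos_divide_le_eq)
    finally show ?thesis by simp
  qed
  then have "\<bar>g x - g y\<bar> \<le> 0" by (rule field_le_epsilon)
  then show ?thesis by simp
qed

lemma rational_reduced_denominator:
  assumes "a \<noteq> 0" "b \<noteq> 0" "b / a \<in> \<rat>"
  obtains p q where "0 < q" "coprime p (int q)" "b / a = of_int p / of_nat q"
    "reduced_denominator a b = enat q"
proof -
  obtain p k where k: "0 < k" "coprime p k" "b / a = of_int p / of_int k"
    using assms(3) by (metis Rats_cases' )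
  have "reduced_denominator a b = enat (nat k)"
    by (rule reduced_denominator_eq[of _ _ _ p]) (use assms k in auto)
  then show thesis using k by (intro that[of "nat k" p]) auto
qed

text \<open>If b / a = p / q in lowest terms, Bezout yields the combination a / q with q > N. If b /
  a is irrational, Dirichlet approximation yields a combination below |a| / N, nonzero by
  irrationality.\<close>

lemma small_integer_combination:
  fixes a b :: real
  assumes "a \<noteq> 0" "b \<noteq> 0" "0 < N" "enat N < reduced_denominator a b"
  obtains m n :: int where "0 < \<bar>of_int m * a + of_int n * b\<bar>"
    "\<bar>of_int m * a + of_int n * b\<bar> < \<bar>a\<bar> / N"
proof (cases "b / a \<in> \<rat>")
  case True
  obtain p q where q: "0 < q" "coprime p (int q)" "b / a = of_int p / of_nat q"
    "reduced_denominator a b = enat q"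
    using rational_reduced_denominator[OF assms(1,2) True] by blast
  have "N < q" using q(4) assms(4) by simp
  obtain m n where "m * p + n * int q = 1"
    using bezout_int[of p "int q"] q(2) by auto
  then have mn: "of_int m * real_of_int p + of_int n * real q = 1"
    by (metis of_int_1 of_int_add of_int_mult of_int_of_nat_eq)
  have "b = a * (of_int p / q)" using q(3) assms(1) by (simp add: divide_eq_eq mult.commute)
  then have "(of_int n * a + of_int m * b) * q = a * (of_int m * real_of_int p + of_int n * real q)"
    using q(1) by (simp add: algebra_simps)
  then have eq: "of_int n * a + of_int m * b = a / q"
    using q(1) mn by (simp add: eq_divide_eq)
  show thesis
    by (rule that[of n m], unfold eq)
      (use q(1) assms(1,3) \<open>N < q\<close> in \<open>auto simp: frac_less2\<close>)
next
  case False
  obtain h k where k: "0 < k" "k \<le> int N" "\<bar>of_int k * (b / a) - of_int h\<bar> < 1 / N"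
    using Dirichlet_approx[OF assms(3)] by blast
  have eq: "of_int (- h) * a + of_int k * b = a * (of_int k * (b / a) - of_int h)"
    using assms(1) by (simp add: field_simps)
  have "of_int k * (b / a) - of_int h \<noteq> 0"
  proof
    assume "of_int k * (b / a) - of_int h = 0"
    then have "b / a = of_int h / of_int k" using k(1) by (simp add: eq_divide_eq mult.commute)
    then show False using False by simp
  qed
  moreover have "\<bar>a\<bar> * \<bar>of_int k * (b / a) - of_int h\<bar> < \<bar>a\<bar> * (1 / N)"
    using k(3) assms(1) by (intro mult_strict_left_mono) auto
  ultimately show thesis
    using assms(1) by (intro that[of "- h" k]) (unfold eq abs_mult, simp_all)
qed

text \<open>For a fixed a in S all reduced denominators are at most some N, hence divide N!, so
  every b in S is an integer multiple of a / N!.\<close>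

lemma common_divisor_of_bounded_denominators:
  assumes "0 \<notin> S" "\<And>a. a \<in> S \<Longrightarrow> (SUP b\<in>S. reduced_denominator a b) \<noteq> \<infinity>"
  obtains g where "0 < g" "\<And>b. b \<in> S \<Longrightarrow> \<exists>k::int. b = of_int k * g"
proof (cases "S = {}")
  \<comment> \<open>The zero measure has empty support, so this case does occur; any positive g will
    do.\<close>
  case True
  then show thesis by (intro that[of 1]) auto
next
  case False
  then obtain a where a: "a \<in> S" by blast
  then have a0: "a \<noteq> 0" using assms(1) by auto
  obtain N where N: "(SUP b\<in>S. reduced_denominator a b) = enat N" using assms(2)[OF a] by auto
  show thesis
  proof (rule that[of "\<bar>a\<bar> / fact N"])
    show "0 < \<bar>a\<bar> / fact N" using a0 by simp
    fix b assume b: "b \<in> S"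
    then have b0: "b \<noteq> 0" using assms(1) by auto
    have le: "reduced_denominator a b \<le> enat N"
      unfolding N[symmetric] using b by (rule SUP_upper)
    have "b / a \<in> \<rat>"
    proof (rule ccontr)
      assume "b / a \<notin> \<rat>"
      then show False using le by (simp add: reduced_denominator_def)
    qed
    then obtain p q where q: "0 < q" "b / a = of_int p / of_nat q" "reduced_denominator a b = enat q"
      using rational_reduced_denominator[OF a0 b0] by metis
    have "q dvd fact N" using q(1,3) le by (intro dvd_fact) auto
    then obtain k where k: "fact N = q * k" by blast
    have fk: "(fact N :: real) = real q * real k" using k by (metis of_nat_fact of_nat_mult)
    have "b = b / a * a" using a0 by simp
    then have "b = of_int p / q * a" by (simp only: q(2))
    also have "\<dots> = of_int p * real k * (a / fact N)"
      using q(1) fact_nonzero[of N, where 'a = real] unfolding fk by (simp add: field_simps)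
    \<comment> \<open>The sign of a moves into the integer factor, as g has to be positive.\<close>
    also have "a / fact N = of_int (if a < 0 then -1 else 1) * (\<bar>a\<bar> / fact N)" by simp
    finally have "b = of_int (p * int k * (if a < 0 then -1 else 1)) * (\<bar>a\<bar> / fact N)" by simp
    then show "\<exists>k::int. b = of_int k * (\<bar>a\<bar> / fact N)" by blast
  qed
qed

section \<open>The Liouville theorem\<close>

context levy_measure
begin

text \<open>Averaging the truncated integral with its reflection replaces the increment by half the
  second difference, which is dominated by a multiple of min (z^2) 1; the principal value thus
  becomes an absolutely convergent integral.\<close>

lemma truncated_integral_tendsto:
  assumes f: "tame R K f" and sym: "distr \<nu> borel uminus = \<nu>"
  shows "((\<lambda>r. \<integral>z. indicator {z. r < \<bar>z\<bar>} z * (f (x + z) - f x) \<partial>\<nu>)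
    \<longlongrightarrow> (\<integral>z. second_diff f z x \<partial>\<nu>) / 2) (at_right 0)"
proof -
  have [measurable]: "f \<in> borel_measurable borel" using f by (rule tame_borel)
  have fK: "\<bar>f y\<bar> \<le> K" for y using f by (simp add: tame_def)
  have half: "(\<integral>z. indicator {z. r < \<bar>z\<bar>} z * (f (x + z) - f x) \<partial>\<nu>)
      = (\<integral>z. indicator {z. r < \<bar>z\<bar>} z * second_diff f z x \<partial>\<nu>) / 2" if r: "0 < r" for r
  proof -
    let ?I = "\<lambda>z. indicator {z. r < \<bar>z\<bar>} z :: real"
    have [measurable]: "{z. r < \<bar>z\<bar>} \<in> sets borel" "{z. r \<le> \<bar>z\<bar>} \<in> sets borel" by measurable
    have int: "integrable \<nu> (\<lambda>z. ?I z * (f (x + s * z) - f x))" for s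
    proof (rule Bochner_Integration.integrable_bound)
      show "integrable \<nu> (\<lambda>z. 2 * K * indicator {z. r \<le> \<bar>z\<bar>} z)"
        using emeasure_away_finite[OF r]
        by (intro integrable_mult_right integrable_real_indicator) (simp_all add: sets_nu)
      have "\<bar>f (x + s * z) - f x\<bar> \<le> \<bar>2 * K\<bar>" for z
        using fK[of "x + s * z"] fK[of x] by linarith
      then show "AE z in \<nu>. norm (?I z * (f (x + s * z) - f x)) \<le> norm (2 * K * indicator {z. r \<le> \<bar>z\<bar>} z)"
        by (auto simp: indicator_def)
    qed measurable
    have "(\<integral>z. ?I z * (f (x + z) - f x) \<partial>\<nu>) = (\<integral>z. ?I z * (f (x + z) - f x) \<partial>distr \<nu> borel uminus)"
      by (simp only: sym)
    also have "\<dots> = (\<integral>z. ?I z * (f (x - z) - f x) \<partial>\<nu>)"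
      by (subst integral_distr) (auto simp: indicator_def)
    finally have "2 * (\<integral>z. ?I z * (f (x + z) - f x) \<partial>\<nu>)
        = (\<integral>z. ?I z * (f (x + z) - f x) \<partial>\<nu>) + (\<integral>z. ?I z * (f (x - z) - f x) \<partial>\<nu>)"
      by simp
    also have "\<dots> = (\<integral>z. ?I z * (f (x + z) - f x) + ?I z * (f (x - z) - f x) \<partial>\<nu>)"
      using int[of 1] int[of "- 1"] by simp
    also have "\<dots> = (\<integral>z. ?I z * second_diff f z x \<partial>\<nu>)"
      by (intro Bochner_Integration.integral_cong) (simp_all add: second_diff_def algebra_simps)
    finally show ?thesis by simp
  qed
  have "((\<lambda>r. \<integral>z. indicator {z. r < \<bar>z\<bar>} z * second_diff f z x \<partial>\<nu>)
    \<longlongrightarrow> (\<integral>z. second_diff f z x \<partial>\<nu>)) (at_right 0)"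
  \<comment> \<open>Dominated convergence is applied along sequences decreasing to 0.\<close>
  proof (rule tendsto_at_right_sequentially[of 0 1])
    fix S :: "nat \<Rightarrow> real" assume S: "\<And>n. 0 < S n" "S \<longlonglongrightarrow> 0"
    show "(\<lambda>n. \<integral>z. indicator {z. S n < \<bar>z\<bar>} z * second_diff f z x \<partial>\<nu>)
      \<longlonglongrightarrow> (\<integral>z. second_diff f z x \<partial>\<nu>)"
    proof (rule integral_dominated_convergence)
      show "integrable \<nu> (\<lambda>z. (4 * K) * min (z\<^sup>2) 1)"
        using moment_integrable by (rule integrable_mult_right)
      have dom: "\<bar>second_diff f z x\<bar> \<le> (4 * K) * min (z\<^sup>2) 1" for z
      proof (cases "z\<^sup>2 \<le> 1")
        case True
        have "K * z\<^sup>2 \<le> (4 * K) * z\<^sup>2" using f by (intro mult_right_mono) (auto simp: tame_def)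
        moreover have "\<bar>second_diff f z x\<bar> \<le> K * z\<^sup>2" using f unfolding tame_def by blast
        moreover have "min (z\<^sup>2) 1 = z\<^sup>2" using True by simp
        ultimately show ?thesis by simp
      next
        case False
        then show ?thesis
          using fK[of "x + z"] fK[of "x - z"] fK[of x] unfolding second_diff_def by (simp add: min_def)
      qed
      show "AE z in \<nu>. norm (indicator {z. S n < \<bar>z\<bar>} z * second_diff f z x) \<le> (4 * K) * min (z\<^sup>2) 1" for n
        using dom order_trans[OF abs_ge_zero dom] by (auto simp: indicator_def)
      show "AE z in \<nu>. (\<lambda>n. indicator {z. S n < \<bar>z\<bar>} z * second_diff f z x) \<longlonglongrightarrow> second_diff f z x"
      proof (rule AE_I2)
        fix z
        show "(\<lambda>n. indicator {z. S n < \<bar>z\<bar>} z * second_diff f z x) \<longlonglongrightarrow> second_diff f z x"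
        proof (cases "z = 0")
          case False
          then have "eventually (\<lambda>n. S n < \<bar>z\<bar>) sequentially"
            using order_tendstoD(2)[OF S(2)] by simp
          then have "eventually (\<lambda>n. indicator {z. S n < \<bar>z\<bar>} z * second_diff f z x = second_diff f z x) sequentially"
            by eventually_elim simp
          then show ?thesis by (rule tendsto_eventually)
        qed (simp add: second_diff_def)
      qed
    qed (simp_all add: second_diff_def)
  qed simp
  then have "((\<lambda>r. (\<integral>z. indicator {z. r < \<bar>z\<bar>} z * second_diff f z x \<partial>\<nu>) / 2)
    \<longlongrightarrow> (\<integral>z. second_diff f z x \<partial>\<nu>) / 2) (at_right 0)"
    by (intro tendsto_divide tendsto_const) auto
  then show ?thesis
  proof (rule Lim_transform_eventually)
    show "eventually (\<lambda>r. (\<integral>z. indicator {z. r < \<bar>z\<bar>} z * second_diff f z x \<partial>\<nu>) / 2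
        = (\<integral>z. indicator {z. r < \<bar>z\<bar>} z * (f (x + z) - f x) \<partial>\<nu>)) (at_right 0)"
      using half by (auto simp: eventually_at_filter)
  qed
qed

text \<open>For each bump the correlation is Lipschitz and has all of S, hence all integer
  combinations of elements of S, as periods. Unbounded denominators make these combinations
  arbitrarily small, so the correlation is constant.\<close>

lemma weakly_harmonic_imp_const:
  assumes u: "u \<in> borel_measurable borel" "\<And>x. \<bar>u x\<bar> \<le> C"
    and harm: "\<And>\<psi>. \<psi> \<in> test_functions \<Longrightarrow> (\<integral>x. u x * (\<integral>z. second_diff \<psi> z x \<partial>\<nu>) \<partial>lborel) = 0"
    and S: "\<And>h. h \<in> S \<Longrightarrow> h \<noteq> 0 \<and> (\<forall>r>0. 0 < emeasure \<nu> (ball h r))"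
    and a: "a \<in> S" "(SUP b\<in>S. reduced_denominator a b) = \<infinity>"
  shows "\<exists>c. AE x in lborel. u x = c"
proof (rule AE_const_of_bump_invariance[OF u])
  fix c d :: real and n x assume cd: "c < d"
  let ?f = "bump c d (Suc n)"
  have shifts: "(\<lambda>y. ?f (y - t)) \<in> test_functions" for t
    unfolding bump_shift using cd by (intro bump_test_function) auto
  have "?f \<in> test_functions" using cd by (intro bump_test_function) auto
  then obtain R K where "tame R K ?f" using test_function_tame by blast
  then interpret bounded_times_tame u ?f C R K by unfold_locales (use u in auto)
  let ?v = "correlation u ?f"
  have per: "?v (y + h) = ?v y" if "h \<in> S" for y h
    using correlation_periodic[OF bounded_times_tame_axioms harm shifts] S[OF that] by blast
  have "?v x = ?v 0"
  proof (rule lipschitz_small_periods_const[OF correlation_lipschitz])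
    fix e :: real assume e: "0 < e"
    \<comment> \<open>N is chosen with |a| / N < e.\<close>
    obtain N where N: "\<bar>a\<bar> / e < real N" using reals_Archimedean2 by blast
    have "0 < N" using N e S[OF a(1)] by (intro gr0I) (auto simp: divide_less_0_iff)
    have "enat N < (SUP b\<in>S. reduced_denominator a b)" using a(2) by simp
    then obtain b where b: "b \<in> S" "enat N < reduced_denominator a b"
      by (auto simp: less_SUP_iff)
    obtain i j :: int where ij: "0 < \<bar>of_int i * a + of_int j * b\<bar>"
        "\<bar>of_int i * a + of_int j * b\<bar> < \<bar>a\<bar> / N"
      using small_integer_combination[OF _ _ \<open>0 < N\<close> b(2)] S[OF a(1)] S[OF b(1)] by metis
    have "\<bar>a\<bar> / N < e" using N e \<open>0 < N\<close> by (simp add: divide_less_eq mult.commute)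
    moreover have "?v (y + (of_int i * a + of_int j * b)) = ?v y" for y
      using int_multiple_period[of ?v a "y + of_int j * b" i] int_multiple_period[of ?v b y j]
        per[OF a(1)] per[OF b(1)] by (simp add: algebra_simps)
    ultimately show "\<exists>t. 0 < \<bar>t\<bar> \<and> \<bar>t\<bar> < e \<and> (\<forall>x. ?v (x + t) = ?v x)"
      using ij by (intro exI[of _ "of_int i * a + of_int j * b"]) auto
  qed
  then show "(\<integral>y. u y * ?f (y - x) \<partial>lborel) = (\<integral>y. u y * ?f y \<partial>lborel)"
    by (simp add: correlation_def)
qed

end

text \<open>A Lebesgue measurable function agrees almost everywhere with a Borel one; clipping it at
  the essential bound makes the bound hold everywhere.\<close>

lemma L_infinity_borel_version:
  assumes "u \<in> L_infinity"
  obtains w C where "w \<in> borel_measurable borel" "\<And>x. \<bar>w x\<bar> \<le> C" "AE x in lebesgue. u x = w x"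
proof -
  obtain C where u: "u \<in> borel_measurable lebesgue" and C: "AE x in lebesgue. \<bar>u x\<bar> \<le> C"
    using assms by (auto simp: L_infinity_def)
  obtain u' where u': "u' \<in> borel_measurable lborel" "AE x in lborel. u x = u' x"
    using completion_ex_borel_measurable_real[OF u] by blast
  let ?w = "\<lambda>x. max (- \<bar>C\<bar>) (min \<bar>C\<bar> (u' x))"
  show thesis
  proof (rule that)
    show "?w \<in> borel_measurable borel" using u'(1) by simp
    show "\<bar>?w x\<bar> \<le> \<bar>C\<bar>" for x by (simp add: abs_le_iff)
    show "AE x in lebesgue. u x = ?w x"
      using C AE_completion[OF u'(2)] by eventually_elim linarith
  qed
qed

text \<open>The exceptional set is open and negligible, hence empty.\<close>

lemma continuous_AE_const:
  fixes f :: "real \<Rightarrow> real"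
  assumes "continuous_on UNIV f" "AE x in lebesgue. f x = c"
  shows "f x = c"
proof (rule ccontr)
  assume "f x \<noteq> c"
  have "{x. f x \<noteq> c} = f -` (- {c})" by auto
  then have "open {x. f x \<noteq> c}"
    using assms(1) open_Compl[OF closed_singleton[of c]] by (simp only: continuous_on_open_vimage[OF open_UNIV]) simp
  moreover have "{x. f x \<noteq> c} \<in> null_sets lebesgue"
    using assms(2) calculation by (subst AE_iff_null_sets) auto
  ultimately show False
    using open_not_negligible[of "{x. f x \<noteq> c}"] \<open>f x \<noteq> c\<close> negligible_iff_null_sets by blast
qed

theorem theorem3p7:
  fixes \<mu> :: "real measure"
  assumes "radon_measure_punctured \<mu>"
    and "symmetric_measure \<mu>"
    and "(\<integral>\<^sup>+ z. ennreal (min (\<bar>z\<bar>\<^sup>2) 1) \<partial>\<mu>) < \<infinity>"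
  shows "(\<forall>u\<in>L_infinity. levy_harmonic \<mu> u \<longrightarrow> (\<exists>c. AE x in lebesgue. u x = c))
     \<longleftrightarrow> (\<exists>a\<in>measure_support \<mu>. (SUP b\<in>measure_support \<mu>. reduced_denominator a b) = \<infinity>)"
proof -
  have sets_mu: "sets \<mu> = sets (restrict_space borel (- {0}))"
    using assms(1) by (simp add: radon_measure_punctured_def)
  have space_mu: "space \<mu> = - {0}"
    using sets_eq_imp_space_eq[OF sets_mu] by (simp add: space_restrict_space)
  have id_meas: "(\<lambda>z. z) \<in> \<mu> \<rightarrow>\<^sub>M borel"
    using measurable_restrict_space1[OF measurable_ident, of borel "- {0}"]
    by (simp add: measurable_cong_sets[OF sets_mu refl] id_def)
  define \<nu> where "\<nu> = distr \<mu> borel (\<lambda>z. z)"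
  have em: "emeasure \<nu> A = emeasure \<mu> (A - {0})" if "A \<in> sets borel" for A
    using that id_meas by (simp add: \<nu>_def emeasure_distr space_mu Diff_eq)
  interpret levy_measure \<nu>
  proof
    show "sets \<nu> = sets borel" by (simp add: \<nu>_def)
    show "emeasure \<nu> {0} = 0" using em[of "{0}"] by simp
    show "(\<integral>\<^sup>+ z. ennreal (min (z\<^sup>2) 1) \<partial>\<nu>) < \<infinity>"
      using assms(3) id_meas by (simp add: \<nu>_def nn_integral_distr)
  qed
  have sym: "distr \<nu> borel uminus = \<nu>"
  proof (rule measure_eqI)
    fix A assume "A \<in> sets (distr \<nu> borel uminus)"
    then have A: "A \<in> sets borel" by simp
    then have vA: "uminus -` A \<in> sets borel"
      using measurable_sets[of uminus borel borel A] by simp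
    have "A - {0} \<in> sets \<mu>"
      unfolding sets_mu sets_restrict_space using A by (auto simp: Diff_eq Int_commute)
    then have "emeasure \<mu> (A - {0}) = emeasure \<mu> (uminus ` (A - {0}))"
      using assms(2) by (simp add: symmetric_measure_def)
    moreover have "uminus ` (A - {0}) = uminus -` A - {0}" by force
    ultimately show "emeasure (distr \<nu> borel uminus) A = emeasure \<nu> A"
      using A vA by (simp add: emeasure_distr em)
  qed (simp add: sets_nu)
  have supp: "h \<in> measure_support \<mu> \<longleftrightarrow> h \<noteq> 0 \<and> (\<forall>r>0. 0 < emeasure \<nu> (ball h r))" for h
    by (simp add: measure_support_def em)
  \<comment> \<open>The principal value exists and is half the second difference integral; the
    factor 1 / 2 is irrelevant for vanishing.\<close>
  have levy: "levy_operator \<mu> \<psi> x = (\<integral>z. second_diff \<psi> z x \<partial>\<nu>) / 2"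
    if "\<psi> \<in> test_functions" for \<psi> x
  proof -
    obtain R K where t: "tame R K \<psi>" using test_function_tame \<open>\<psi> \<in> test_functions\<close> by blast
    then have [measurable]: "\<psi> \<in> borel_measurable borel" by (rule tame_borel)
    have "(LINT z:{z. r < \<bar>z\<bar>}|\<mu>. \<psi> (x + z) - \<psi> x)
        = (\<integral>z. indicator {z. r < \<bar>z\<bar>} z * (\<psi> (x + z) - \<psi> x) \<partial>\<nu>)" for r
      using id_meas by (simp add: \<nu>_def set_lebesgue_integral_def integral_distr)
    then show ?thesis
      unfolding levy_operator_def
      using tendsto_Lim[OF trivial_limit_at_right_real truncated_integral_tendsto[OF t sym]] by simp
  qed
  have potential_borel: "(\<lambda>x. \<integral>z. second_diff \<psi> z x \<partial>\<nu>) \<in> borel_measurable borel"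
    if "\<psi> \<in> test_functions" for \<psi>
  proof -
    obtain R K where "tame R K \<psi>" using test_function_tame \<open>\<psi> \<in> test_functions\<close> by blast
    then have [measurable]: "\<psi> \<in> borel_measurable borel" by (rule tame_borel)
    show ?thesis unfolding second_diff_def by measurable
  qed
  \<comment> \<open>Passes at once from u to a Borel representative w and from
    \<open>lebesgue\<close> to \<open>lborel\<close>, where Fubini is available.\<close>
  have harmonic_iff: "levy_harmonic \<mu> u \<longleftrightarrow>
      (\<forall>\<psi>\<in>test_functions. (\<integral>x. w x * (\<integral>z. second_diff \<psi> z x \<partial>\<nu>) \<partial>lborel) = 0)"
    if u: "u \<in> borel_measurable lebesgue" and w: "w \<in> borel_measurable borel"
      and uw: "AE x in lebesgue. u x = w x" for u w
  proof -
    have eq: "(LINT x|lebesgue. u x * levy_operator \<mu> \<psi> x)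
        = (\<integral>x. w x * (\<integral>z. second_diff \<psi> z x \<partial>\<nu>) \<partial>lborel) / 2"
      if \<psi>: "\<psi> \<in> test_functions" for \<psi>
    proof -
      let ?P = "\<lambda>x. \<integral>z. second_diff \<psi> z x \<partial>\<nu>"
      have P: "?P \<in> borel_measurable lebesgue" and w': "w \<in> borel_measurable lebesgue"
        using potential_borel[OF \<psi>] w by (auto intro: measurable_completion)
      have "(LINT x|lebesgue. u x * levy_operator \<mu> \<psi> x) = (LINT x|lebesgue. w x * ?P x / 2)"
        unfolding levy[OF \<psi>]
        by (rule integral_cong_AE) (use u w' P uw in \<open>auto elim!: eventually_mono\<close>)
      also have "\<dots> = (\<integral>x. w x * ?P x / 2 \<partial>lborel)"
        using w potential_borel[OF \<psi>] by (intro integral_completion) simp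
      finally show ?thesis by simp
    qed
    show ?thesis unfolding levy_harmonic_def by (intro ball_cong refl) (simp only: eq, simp)
  qed
  show ?thesis
  proof
    assume liouville: "\<forall>u\<in>L_infinity. levy_harmonic \<mu> u \<longrightarrow> (\<exists>c. AE x in lebesgue. u x = c)"
    show "\<exists>a\<in>measure_support \<mu>. (SUP b\<in>measure_support \<mu>. reduced_denominator a b) = \<infinity>"
    proof (rule ccontr)
      assume contra: "\<not> (\<exists>a\<in>measure_support \<mu>. (SUP b\<in>measure_support \<mu>. reduced_denominator a b) = \<infinity>)"
      have "0 \<notin> measure_support \<mu>" by (simp add: supp)
      then obtain g where g: "0 < g" "\<And>b. b \<in> measure_support \<mu> \<Longrightarrow> \<exists>k::int. b = of_int k * g"
        using common_divisor_of_bounded_denominators[of "measure_support \<mu>"] contra by metis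
      \<comment> \<open>Every point of the support is an integer multiple of g, hence a period of
        this cosine.\<close>
      define u where "u x = cos (2 * pi / g * x)" for x
      have cont: "continuous_on UNIV u" unfolding u_def by (intro continuous_intros)
      then have borel: "u \<in> borel_measurable borel" by (rule borel_measurable_continuous_onI)
      then have leb: "u \<in> borel_measurable lebesgue" by (auto intro: measurable_completion)
      have bound: "\<bar>u x\<bar> \<le> 1" for x by (simp add: u_def)
      have per: "AE z in \<nu>. \<forall>x. u (x + z) = u x"
        using AE_support
      proof eventually_elim
        case (elim z)
        then obtain k :: int where k: "z = of_int k * g" using g(2) supp by blast
        have "2 * pi / g * (x + z) = 2 * pi / g * x + 2 * pi * of_int k" for x
          using g(1) by (simp add: k distrib_left)
        then have "u (x + z) = cos (2 * pi / g * x + 2 * pi * of_int k)" for x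
          by (simp only: u_def)
        then show ?case by (simp add: u_def cos_add sin_int_2pin cos_int_2pin)
      qed
      have "levy_harmonic \<mu> u"
        unfolding harmonic_iff[OF leb borel AE_I2[OF refl]]
      proof
        fix \<psi> assume "\<psi> \<in> test_functions"
        then obtain R K where "tame R K \<psi>" using test_function_tame by blast
        then have "bounded_times_tame u \<psi> 1 R K" using borel bound by unfold_locales
        then show "(\<integral>x. u x * (\<integral>z. second_diff \<psi> z x \<partial>\<nu>) \<partial>lborel) = 0"
          using per by (rule periodic_weakly_harmonic)
      qed
      moreover have "u \<in> L_infinity" using leb bound by (auto simp: L_infinity_def)
      ultimately obtain c where "AE x in lebesgue. u x = c" using liouville by blast
      \<comment> \<open>At these two points the cosine takes the values 1 and -1.\<close>
      then have "u 0 = c" "u (g / 2) = c" using continuous_AE_const[OF cont] by blast+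
      then show False using g(1) by (simp add: u_def)
    qed
  next
    assume "\<exists>a\<in>measure_support \<mu>. (SUP b\<in>measure_support \<mu>. reduced_denominator a b) = \<infinity>"
    then obtain a where a: "a \<in> measure_support \<mu>"
      "(SUP b\<in>measure_support \<mu>. reduced_denominator a b) = \<infinity>" by blast
    show "\<forall>u\<in>L_infinity. levy_harmonic \<mu> u \<longrightarrow> (\<exists>c. AE x in lebesgue. u x = c)"
    proof (intro ballI impI)
      fix u assume u: "u \<in> L_infinity" and harm: "levy_harmonic \<mu> u"
      obtain w C where w: "w \<in> borel_measurable borel" "\<And>x. \<bar>w x\<bar> \<le> C" "AE x in lebesgue. u x = w x"
        using L_infinity_borel_version[OF u] by blast
      have "u \<in> borel_measurable lebesgue" using u by (simp add: L_infinity_def)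
      then have "(\<integral>x. w x * (\<integral>z. second_diff \<psi> z x \<partial>\<nu>) \<partial>lborel) = 0" if "\<psi> \<in> test_functions" for \<psi>
        using harmonic_iff[OF _ w(1,3)] harm that by blast
      then obtain c where "AE x in lborel. w x = c"
        using weakly_harmonic_imp_const[OF w(1,2) _ _ a] supp by blast
      then have "AE x in lebesgue. w x = c" by (rule AE_completion)
      with w(3) have "AE x in lebesgue. u x = c" by eventually_elim simp
      then show "\<exists>c. AE x in lebesgue. u x = c" ..
    qed
  qed
qed

end
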